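(* In the Grothendieck ring of representations of the upper Borel part $\mathfrak b_+$ of $U_q(C^{(2)}(2))$ one has the Baxter relations $$[W_1(\lambda)][\rho_+(\lambda)]=[U_1][\rho_+(q_*\lambda)]-\sigma[U_{-1}][\rho_+(q_*^{-1}\lambda)],$$ $$[W_1(\lambda)][\rho_-(\lambda)]=[U_1][\rho_-(q_*^{-1}\lambda)]-\sigma[U_{-1}][\rho_-(q_*\lambda)].$$
   Context: $q=e^{\pi ib^2}$, $q_*:=-iq=e^{\pi ib_*^2}$, $b^2=b_*^2+\frac12$. $\mathfrak b_+$ is generated by odd $\mathcal E_0,\mathcal E_1$ and even $\mathcal K_0,\mathcal K_1$ with $\mathcal K_i\mathcal E_j=q^{a_{ij}}\mathcal E_j\mathcal K_i$, $(a_{ij})=\begin{pmatrix}2&-2\\-2&2\end{pmatrix}$, and the Serre relations $\mathcal E_i^3\mathcal E_j+\{3\}_q\mathcal E_i^2\mathcal E_j\mathcal E_i-\{3\}_q\mathcal E_i\mathcal E_j\mathcal E_i^2-\mathcal E_j\mathcal E_i^3=0$ ($i\ne j$), $\{3\}_q=\frac{q^3+q^{-3}}{q+q^{-1}}$. Coproduct: $\Delta(\mathcal E_i)=\mathcal E_i\otimes\mathcal K_i+1\otimes\mathcal E_i$, $\Delta(\mathcal K_i)=\mathcal K_i\otimes\mathcal K_i$; tensor products are super. Representations: - Prefundamental ($q$-oscillator) representations $\rho_\pm(\lambda)$: let $\alpha_+,\alpha_-$ (odd) and $\mathcal H$ satisfy $q\alpha_+\alpha_-+q^{-1}\alpha_-\alpha_+=-\frac1{q+q^{-1}}$,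 $[\mathcal H,\alpha_\pm]=\pm2\alpha_\pm$, with Fock modules $\Pi_\pm=\mathrm{span}\{\alpha_\pm^k|0\rangle_\pm:\ \mathcal H|0\rangle_\pm=0,\ \alpha_\mp|0\rangle_\pm=0\}_{k\ge0}$, the vacuum vectors being even. $\rho_\pm(\lambda)$ is given by $\mathcal E_1=\lambda\alpha_\pm$, $\mathcal E_0=\lambda\alpha_\mp$, $\mathcal K_1=q^{\pm\mathcal H}$, $\mathcal K_0=q^{\mp\mathcal H}$, acting on $\Pi_\mp$. - $W_1(\lambda)=W_1^+(\lambda)$: the two-dimensional evaluation module with even basis vector $v_{1/2}$ (highest weight vector) and odd basis vector $v_{-1/2}$; $\mathcal E_1v_{-1/2}=\lambda v_{1/2}$, $\mathcal E_1v_{1/2}=0$, $\mathcal E_0v_{1/2}=\lambda v_{-1/2}$, $\mathcal E_0v_{-1/2}=0$, $\mathcal K_1v_{1/2}=q_*v_{1/2}$, $\mathcal K_1v_{-1/2}=-q_*^{-1}v_{-1/2}$, $\mathcal K_0=\mathcal K_1^{-1}$. - $U_p=U_p^+$: one-dimensional with even generator, $\mathcal E_0,\mathcal E_1$ acting as $0$, $\mathcal K_1,\mathcal K_0$ acting as $q_*^p,q_*^{-p}$. $U_p^-$: one-dimensional with odd generator, $\mathcal E_i$ acting as $0$ and $\mathcal K_1,\mathcal K_0$ as $-q_*^p,-q_*^{-p}$. The parity element is $\sigma:=[U_0^-]$; thus $\sigma^2=1$ and $\sigma[U_p^\pm]=[U_p^\mp]$.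
   Formalization: With additive classes and σ=[U_0^-] the minus sign is false; here the class of a module with an odd highest weight vector is negated, so σ is minus the additive class of U_0^- and the second term is + in plain classes. Representations lie in category O; q+1/q≠0 is assumed. *)

theory Defs
  imports Complex_Main "HOL-Library.Poly_Mapping" "HOL-Library.Nat_Bijection"
    "HOL-Algebra.QuotRing"
begin

section \<open>Vectors and linear maps\<close>

text \<open>All modules below have countable dimension, so they are realised on spans of
  standard basis vectors in the space of finitely supported functions on the naturals.
  Linear maps are given by the images of the basis vectors.\<close>

type_synonym vec = "nat \<Rightarrow>\<^sub>0 complex"

definition smul :: "complex \<Rightarrow> vec \<Rightarrow> vec" where
  "smul c v = Poly_Mapping.map ((*) c) v"

definition lin :: "(nat \<Rightarrow> vec) \<Rightarrow> vec \<Rightarrow> vec" where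
  "lin F v = (\<Sum>i\<in>Poly_Mapping.keys v. smul (Poly_Mapping.lookup v i) (F i))"

definition vtensor :: "vec \<Rightarrow> vec \<Rightarrow> vec" where
  "vtensor v w = (\<Sum>i\<in>Poly_Mapping.keys v. \<Sum>j\<in>Poly_Mapping.keys w.
     Poly_Mapping.single (prod_encode (i, j))
       (Poly_Mapping.lookup v i * Poly_Mapping.lookup w j))"


section \<open>Representations of the Borel part\<close>

datatype node = N0 | N1

datatype gen = E node | K node

fun acoeff :: "node \<Rightarrow> node \<Rightarrow> int" where
  "acoeff i j = (if i = j then 2 else - 2)"

text \<open>A super vector space with a homogeneous basis indexed by \<open>Idx\<close> (\<open>odd_idx\<close> selects the odd
  basis vectors), and the images \<open>act M g i\<close> of the basis vectors under the generators.
  Values at indices outside \<open>Idx\<close> are irrelevant.\<close>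

record srep =
  Idx :: "nat set"
  odd_idx :: "nat \<Rightarrow> bool"
  act :: "gen \<Rightarrow> nat \<Rightarrow> vec"

definition vspace :: "srep \<Rightarrow> vec set" where
  "vspace M = {v. Poly_Mapping.keys v \<subseteq> Idx M}"

definition opr :: "srep \<Rightarrow> gen \<Rightarrow> vec \<Rightarrow> vec" where
  "opr M g = lin (act M g)"

definition three_q :: "complex \<Rightarrow> complex" where
  "three_q q = (q ^ 3 + inverse q ^ 3) / (q + inverse q)"

definition is_rep :: "complex \<Rightarrow> srep \<Rightarrow> bool" where
  "is_rep q M \<longleftrightarrow>
     (\<forall>g. \<forall>i\<in>Idx M. Poly_Mapping.keys (act M g i) \<subseteq> Idx M) \<and>
     (\<forall>n. \<forall>i\<in>Idx M. \<forall>j\<in>Poly_Mapping.keys (act M (E n) i). odd_idx M j \<noteq> odd_idx M i) \<and>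
     (\<forall>n. \<forall>i\<in>Idx M. \<forall>j\<in>Poly_Mapping.keys (act M (K n) i). odd_idx M j = odd_idx M i) \<and>
     (\<forall>i j. \<forall>v\<in>vspace M.
        opr M (K i) (opr M (E j) v) = smul (q powi acoeff i j) (opr M (E j) (opr M (K i) v))) \<and>
     (\<forall>i j. \<forall>v\<in>vspace M. i \<noteq> j \<longrightarrow>
        (let x = opr M (E i); y = opr M (E j) in
           x (x (x (y v))) + smul (three_q q) (x (x (y (x v))))
             - smul (three_q q) (x (y (x (x v)))) - y (x (x (x v))) = 0))"

text \<open>Even module homomorphisms and short exact sequences.\<close>

definition is_hom :: "srep \<Rightarrow> srep \<Rightarrow> (nat \<Rightarrow> vec) \<Rightarrow> bool" where
  "is_hom M N F \<longleftrightarrow>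
     (\<forall>i\<in>Idx M. Poly_Mapping.keys (F i) \<subseteq> Idx N) \<and>
     (\<forall>i\<in>Idx M. \<forall>j\<in>Poly_Mapping.keys (F i). odd_idx N j = odd_idx M i) \<and>
     (\<forall>g. \<forall>v\<in>vspace M. lin F (opr M g v) = opr N g (lin F v))"

definition short_exact :: "srep \<Rightarrow> srep \<Rightarrow> srep \<Rightarrow> bool" where
  "short_exact A B C \<longleftrightarrow>
     (\<exists>F G. is_hom A B F \<and> is_hom B C G \<and>
        inj_on (lin F) (vspace A) \<and>
        {v \<in> vspace B. lin G v = 0} = lin F ` vspace A \<and>
        lin G ` vspace B = vspace C)"

text \<open>Super tensor product for \<open>\<Delta>(E) = E \<otimes> K + 1 \<otimes> E\<close> and \<open>\<Delta>(K) = K \<otimes> K\<close>; the sign comes from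
  moving the odd \<open>E\<close> past an odd vector of the first factor.\<close>

definition tensor :: "srep \<Rightarrow> srep \<Rightarrow> srep" where
  "tensor M N = \<lparr>
     Idx = prod_encode ` (Idx M \<times> Idx N),
     odd_idx = (\<lambda>k. case prod_decode k of (i, j) \<Rightarrow> odd_idx M i \<noteq> odd_idx N j),
     act = (\<lambda>g k. case prod_decode k of (i, j) \<Rightarrow>
       (case g of
          E n \<Rightarrow> vtensor (act M (E n) i) (act N (K n) j)
            + smul (if odd_idx M i then - 1 else 1)
                (vtensor (Poly_Mapping.single i 1) (act N (E n) j))
        | K n \<Rightarrow> vtensor (act M (K n) i) (act N (K n) j))) \<rparr>"


section \<open>The Grothendieck ring\<close>

text \<open>Without a finiteness condition the Grothendieck ring would be zero (Eilenberg swindle: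
  the sum of countably many copies of a module absorbs one more copy). The modules are therefore
  those of category \<open>\<O>\<close>: the Cartan part is diagonalisable with nonzero eigenvalues, and the
  weights, counted with multiplicities, lie in finitely many cones
  \<open>{(\<kappa>\<^sub>0 q\<^sup>2\<^sup>d, \<kappa>\<^sub>1 q\<^sup>-\<^sup>2\<^sup>d). d \<ge> 0}\<close>, with finitely many basis vectors at each point of each cone.
  Up to isomorphism one may choose a homogeneous basis of weight vectors. For \<open>q\<close> not a root of
  unity this means finite-dimensional weight spaces and weights in finitely many cones.\<close>

definition catO :: "complex \<Rightarrow> srep set" where
  "catO q = {M. is_rep q M \<and>
     (\<exists>(top0 :: nat \<Rightarrow> complex) (top1 :: nat \<Rightarrow> complex) (d :: nat \<Rightarrow> nat).
        finite ((\<lambda>i. (top0 i, top1 i)) ` Idx M) \<and>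
        (\<forall>k. finite {i \<in> Idx M. d i = k}) \<and>
        (\<forall>i\<in>Idx M. top0 i \<noteq> 0 \<and> top1 i \<noteq> 0 \<and>
           act M (K N0) i = Poly_Mapping.single i (top0 i * q powi (2 * int (d i))) \<and>
           act M (K N1) i = Poly_Mapping.single i (top1 i * q powi (- 2 * int (d i)))))}"

inductive_set exact_rel :: "complex \<Rightarrow> (srep \<Rightarrow>\<^sub>0 int) set" for q :: complex where
  zero: "0 \<in> exact_rel q"
| ses: "\<lbrakk>A \<in> catO q; B \<in> catO q; C \<in> catO q; short_exact A B C\<rbrakk>
    \<Longrightarrow> frag_of B - frag_of A - frag_of C \<in> exact_rel q"
| diff: "\<lbrakk>x \<in> exact_rel q; y \<in> exact_rel q\<rbrakk> \<Longrightarrow> x - y \<in> exact_rel q"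

definition tensor_frag :: "(srep \<Rightarrow>\<^sub>0 int) \<Rightarrow> (srep \<Rightarrow>\<^sub>0 int) \<Rightarrow> (srep \<Rightarrow>\<^sub>0 int)" where
  "tensor_frag x y = (\<Sum>M\<in>Poly_Mapping.keys x. \<Sum>N\<in>Poly_Mapping.keys y.
     Poly_Mapping.single (tensor M N) (Poly_Mapping.lookup x M * Poly_Mapping.lookup y N))"

datatype pm = Plus | Minus

fun opp :: "pm \<Rightarrow> pm" where
  "opp Plus = Minus"
| "opp Minus = Plus"

fun sg :: "pm \<Rightarrow> int" where
  "sg Plus = 1"
| "sg Minus = - 1"

text \<open>The one-dimensional module \<open>U\<^sub>p\<^sup>\<plusminus>\<close>; the parameter \<open>s\<close> is \<open>q\<^sub>*\<close>.\<close>

definition U :: "complex \<Rightarrow> pm \<Rightarrow> int \<Rightarrow> srep" where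
  "U s \<epsilon> p = \<lparr>
     Idx = {0},
     odd_idx = (\<lambda>_. \<epsilon> = Minus),
     act = (\<lambda>g i. case g of
         E n \<Rightarrow> 0
       | K N1 \<Rightarrow> Poly_Mapping.single i (of_int (sg \<epsilon>) * s powi p)
       | K N0 \<Rightarrow> Poly_Mapping.single i (of_int (sg \<epsilon>) * s powi (- p))) \<rparr>"

text \<open>The free abelian group on the modules with the tensor product is associative and unital only
  up to isomorphism; it becomes a ring after dividing by the short exact sequences (which include
  the isomorphisms).\<close>

definition pre_groth :: "complex \<Rightarrow> (srep \<Rightarrow>\<^sub>0 int) ring" where
  "pre_groth q = \<lparr>
     carrier = {x. Poly_Mapping.keys x \<subseteq> catO q},
     mult = tensor_frag,
     one = frag_of (U 1 Plus 0),
     zero = 0,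
     add = (+) \<rparr>"

definition groth :: "complex \<Rightarrow> (srep \<Rightarrow>\<^sub>0 int) set ring" where
  "groth q = pre_groth q Quot exact_rel q"

definition cls :: "complex \<Rightarrow> srep \<Rightarrow> (srep \<Rightarrow>\<^sub>0 int) set" where
  "cls q M = exact_rel q +>\<^bsub>pre_groth q\<^esub> frag_of M"

definition generates :: "srep \<Rightarrow> vec \<Rightarrow> bool" where
  "generates M v \<longleftrightarrow>
     (\<forall>S \<subseteq> vspace M. v \<in> S \<and> (\<forall>x\<in>S. \<forall>y\<in>S. x + y \<in> S) \<and> (\<forall>c. \<forall>x\<in>S. smul c x \<in> S) \<and>
        (\<forall>g. \<forall>x\<in>S. opr M g x \<in> S) \<longrightarrow> S = vspace M)"

definition highest_weight_vector :: "srep \<Rightarrow> vec \<Rightarrow> bool" where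
  "highest_weight_vector M v \<longleftrightarrow>
     v \<in> vspace M \<and> v \<noteq> 0 \<and> opr M (E N1) v = 0 \<and>
     (\<forall>n. \<exists>\<kappa>. opr M (K n) v = smul \<kappa> v) \<and> generates M v"

definition odd_highest :: "srep \<Rightarrow> bool" where
  "odd_highest M \<longleftrightarrow>
     (\<exists>v. highest_weight_vector M v \<and> (\<forall>i\<in>Poly_Mapping.keys v. odd_idx M i))"

text \<open>The bracket \<open>[M]\<close>. Sign convention: a module with an odd highest weight vector enters with the
  opposite sign, so that \<open>[U\<^sub>0\<^sup>-] = - cls U\<^sub>0\<^sup>-\<close>; this is compatible with \<open>\<sigma>\<^sup>2 = 1\<close> and
  \<open>\<sigma>[U\<^sub>p\<^sup>\<plusminus>] = [U\<^sub>p\<^sup>\<mp>]\<close>. It accounts for the minus sign in the Baxter relations: with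
  the plain additive class \<open>cls\<close> in place of the bracket, the second term has a plus sign, as
  comparing dimensions of weight spaces for \<open>q\<close> not a root of unity shows.\<close>

definition bracket :: "complex \<Rightarrow> srep \<Rightarrow> (srep \<Rightarrow>\<^sub>0 int) set" where
  "bracket q M = (if odd_highest M then \<ominus>\<^bsub>groth q\<^esub> cls q M else cls q M)"


section \<open>The evaluation and prefundamental modules\<close>

text \<open>Indices \<open>0\<close> and \<open>1\<close> stand for \<open>v\<^sub>1\<^sub>/\<^sub>2\<close> and \<open>v\<^sub>-\<^sub>1\<^sub>/\<^sub>2\<close>; \<open>s\<close> is \<open>q\<^sub>*\<close>.\<close>

definition W1 :: "complex \<Rightarrow> complex \<Rightarrow> srep" where
  "W1 s lam = \<lparr>
     Idx = {0, 1},
     odd_idx = (\<lambda>i. i = 1),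
     act = (\<lambda>g i. case g of
         E N1 \<Rightarrow> (if i = 1 then Poly_Mapping.single 0 lam else 0)
       | E N0 \<Rightarrow> (if i = 0 then Poly_Mapping.single 1 lam else 0)
       | K N1 \<Rightarrow> Poly_Mapping.single i (if i = 0 then s else - inverse s)
       | K N0 \<Rightarrow> Poly_Mapping.single i (inverse (if i = 0 then s else - inverse s))) \<rparr>"

text \<open>The Fock module \<open>\<Pi>\<^sub>\<epsilon>\<close> has the basis vectors \<open>w\<^sub>k = \<alpha>\<^sub>\<epsilon>\<^sup>k|0\<rangle>\<close>. The other generator
  annihilates the vacuum, and the oscillator relation forces it to map \<open>w\<^sub>k\<close> to a
  multiple \<open>osc_coeff q \<epsilon> k\<close> of \<open>w\<^sub>k\<^sub>-\<^sub>1\<close>.\<close>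

definition osc_const :: "complex \<Rightarrow> complex" where
  "osc_const q = - 1 / (q + inverse q)"

fun osc_coeff :: "complex \<Rightarrow> pm \<Rightarrow> nat \<Rightarrow> complex" where
  "osc_coeff q \<epsilon> 0 = 0"
| "osc_coeff q \<epsilon> (Suc k) =
     q powi sg \<epsilon> * osc_const q - q powi (2 * sg \<epsilon>) * osc_coeff q \<epsilon> k"

text \<open>\<open>\<alpha>\<^sub>\<delta>\<close> and the eigenvalues of \<open>\<H>\<close> on \<open>\<Pi>\<^sub>\<epsilon>\<close>.\<close>

definition alpha :: "complex \<Rightarrow> pm \<Rightarrow> pm \<Rightarrow> nat \<Rightarrow> vec" where
  "alpha q \<epsilon> \<delta> k =
     (if \<delta> = \<epsilon> then Poly_Mapping.single (k + 1) 1
      else Poly_Mapping.single (k - 1) (osc_coeff q \<epsilon> k))"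

definition H_eig :: "pm \<Rightarrow> nat \<Rightarrow> int" where
  "H_eig \<epsilon> k = 2 * sg \<epsilon> * int k"

definition rho :: "complex \<Rightarrow> pm \<Rightarrow> complex \<Rightarrow> srep" where
  "rho q \<epsilon> lam = \<lparr>
     Idx = UNIV,
     odd_idx = odd,
     act = (\<lambda>g k. case g of
         E N1 \<Rightarrow> smul lam (alpha q (opp \<epsilon>) \<epsilon> k)
       | E N0 \<Rightarrow> smul lam (alpha q (opp \<epsilon>) (opp \<epsilon>) k)
       | K N1 \<Rightarrow> Poly_Mapping.single k (q powi (sg \<epsilon> * H_eig (opp \<epsilon>) k))
       | K N0 \<Rightarrow> Poly_Mapping.single k (q powi (- sg \<epsilon> * H_eig (opp \<epsilon>) k))) \<rparr>"


section \<open>Checks of the definitions\<close>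

lemma q_star_eq:
  fixes b bs :: complex
  assumes "b\<^sup>2 = bs\<^sup>2 + 1 / 2"
  shows "- \<i> * exp (complex_of_real pi * \<i> * b\<^sup>2) = exp (complex_of_real pi * \<i> * bs\<^sup>2)"
proof -
  have "exp (complex_of_real pi * \<i> * b\<^sup>2)
      = exp (complex_of_real pi * \<i> * bs\<^sup>2) * exp (\<i> * complex_of_real (pi / 2))"
    unfolding assms exp_add[symmetric] by (simp add: algebra_simps)
  also have "exp (\<i> * complex_of_real (pi / 2)) = \<i>"
    by (metis cis_conv_exp cis_pi_half)
  finally show ?thesis by (simp add: algebra_simps)
qed

lemma lookup_smul [simp]: "Poly_Mapping.lookup (smul c v) i = c * Poly_Mapping.lookup v i"
  by (simp add: smul_def Poly_Mapping.map.rep_eq when_def)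

lemma smul_single [simp]: "smul c (Poly_Mapping.single i a) = Poly_Mapping.single i (c * a)"
  by (rule poly_mapping_eqI) (simp add: lookup_single when_def)

lemma smul_zero [simp]: "smul 0 v = 0" "smul c 0 = 0"
  by (rule poly_mapping_eqI, simp)+

lemma smul_simps: "smul c (smul d v) = smul (c * d) v" "smul c (v + w) = smul c v + smul c w"
  "smul c (v - w) = smul c v - smul c w" "smul (c + d) v = smul c v + smul d v"
  by (rule poly_mapping_eqI, simp add: lookup_add lookup_minus algebra_simps)+

lemma smul_sum: "smul c (sum f A) = (\<Sum>i\<in>A. smul c (f i))"
  by (induction A rule: infinite_finite_induct) (simp_all add: smul_simps)

lemma lin_zero [simp]: "lin F 0 = 0"
  by (simp add: lin_def)

lemma lin_single: "lin F (Poly_Mapping.single i a) = smul a (F i)"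
  by (cases "a = 0") (simp_all add: lin_def)

lemma lin_superset:
  assumes "finite A" "Poly_Mapping.keys v \<subseteq> A"
  shows "lin F v = (\<Sum>i\<in>A. smul (Poly_Mapping.lookup v i) (F i))"
  unfolding lin_def using assms
  by (intro sum.mono_neutral_left) (auto simp: in_keys_iff)

lemma lin_add: "lin F (v + w) = lin F v + lin F w"
proof -
  let ?A = "Poly_Mapping.keys v \<union> Poly_Mapping.keys w"
  have "lin F (v + w) = (\<Sum>i\<in>?A. smul (Poly_Mapping.lookup (v + w) i) (F i))"
    by (rule lin_superset) (use keys_add[of v w] in auto)
  also have "\<dots> = lin F v + lin F w"
    using lin_superset[of ?A v F] lin_superset[of ?A w F]
    by (simp add: lookup_add smul_simps sum.distrib)
  finally show ?thesis .
qed

lemma lin_smul: "lin F (smul c v) = smul c (lin F v)"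
  by (subst lin_superset[of "Poly_Mapping.keys v"])
    (auto simp: in_keys_iff lin_def smul_sum smul_simps)

lemma lin_sum: "lin F (sum f A) = (\<Sum>i\<in>A. lin F (f i))"
  by (induction A rule: infinite_finite_induct) (simp_all add: lin_add)

lemma lin_lin: "lin F (lin G v) = lin (\<lambda>i. lin F (G i)) v"
  by (simp add: lin_def[of G] lin_sum lin_smul) (simp add: lin_def[of "\<lambda>i. lin F (G i)"])

lemma smul_lin: "smul c (lin F v) = lin (\<lambda>i. smul c (F i)) v"
  by (simp add: lin_def smul_sum smul_simps mult.commute)

lemma lin_plus: "lin F v + lin G v = lin (\<lambda>i. F i + G i) v"
  by (simp add: lin_def smul_simps sum.distrib)

lemma lin_minus: "lin F v - lin G v = lin (\<lambda>i. F i - G i) v"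
  by (simp add: lin_def smul_simps sum_subtractf)

lemma lin_cong: "(\<And>i. i \<in> Poly_Mapping.keys v \<Longrightarrow> F i = G i) \<Longrightarrow> lin F v = lin G v"
  by (simp add: lin_def)

lemma lin_0: "(\<And>i. i \<in> Poly_Mapping.keys v \<Longrightarrow> F i = 0) \<Longrightarrow> lin F v = 0"
  by (simp add: lin_def)

lemma osc_relation:
  assumes "q \<noteq> 0"
  shows "smul q (lin (alpha q \<epsilon> Plus) (alpha q \<epsilon> Minus k))
      + smul (inverse q) (lin (alpha q \<epsilon> Minus) (alpha q \<epsilon> Plus k))
      = Poly_Mapping.single k (osc_const q)"
  using assms
  by (cases \<epsilon>; cases k)
    (simp_all add: alpha_def lin_single power_int_minus
      field_simps power2_eq_square flip: single_add)

lemma H_alpha: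
  "lin (\<lambda>i. Poly_Mapping.single i (of_int (H_eig \<epsilon> i))) (alpha q \<epsilon> \<delta> k)
     - smul (of_int (H_eig \<epsilon> k)) (alpha q \<epsilon> \<delta> k)
   = smul (2 * of_int (sg \<delta>)) (alpha q \<epsilon> \<delta> k)"
  by (cases \<epsilon>; cases \<delta>; cases k)
    (simp_all add: alpha_def lin_single H_eig_def algebra_simps flip: single_diff)

text \<open>It suffices to check the relations on basis vectors.\<close>

lemma is_repI:
  assumes "\<And>g i. i \<in> Idx M \<Longrightarrow> Poly_Mapping.keys (act M g i) \<subseteq> Idx M"
    and "\<And>n i j. i \<in> Idx M \<Longrightarrow> j \<in> Poly_Mapping.keys (act M (E n) i) \<Longrightarrow> odd_idx M j \<noteq> odd_idx M i"
    and "\<And>n i j. i \<in> Idx M \<Longrightarrow> j \<in> Poly_Mapping.keys (act M (K n) i) \<Longrightarrow> odd_idx M j = odd_idx M i"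
    and "\<And>i j k. k \<in> Idx M \<Longrightarrow>
        opr M (K i) (act M (E j) k) = smul (q powi acoeff i j) (opr M (E j) (act M (K i) k))"
    and "\<And>i j k. k \<in> Idx M \<Longrightarrow> i \<noteq> j \<Longrightarrow>
        (let x = opr M (E i); y = opr M (E j); x' = act M (E i) k; y' = act M (E j) k in
           x (x (x y')) + smul (three_q q) (x (x (y x')))
             - smul (three_q q) (x (y (x x'))) - y (x (x x')) = 0)"
  shows "is_rep q M"
  unfolding is_rep_def
proof (intro conjI allI ballI impI)
  fix i j v assume v: "v \<in> vspace M"
  show "opr M (K i) (opr M (E j) v) = smul (q powi acoeff i j) (opr M (E j) (opr M (K i) v))"
    unfolding opr_def lin_lin smul_lin
    using v assms(4) by (intro lin_cong) (auto simp: vspace_def opr_def smul_lin simp del: acoeff.simps)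
next
  fix i j v assume v: "v \<in> vspace M" and ij: "i \<noteq> (j :: node)"
  show "let x = opr M (E i); y = opr M (E j) in
           x (x (x (y v))) + smul (three_q q) (x (x (y (x v))))
             - smul (three_q q) (x (y (x (x v)))) - y (x (x (x v))) = 0"
    unfolding Let_def opr_def lin_lin smul_lin lin_plus lin_minus
    using v assms(5)[OF _ ij] by (intro lin_0) (auto simp: vspace_def opr_def Let_def lin_lin smul_lin)
qed (use assms(1-3) in auto)

lemma catO_I:
  fixes top0 top1 :: "nat \<Rightarrow> complex" and d :: "nat \<Rightarrow> nat"
  assumes "is_rep q M" "finite ((\<lambda>i. (top0 i, top1 i)) ` Idx M)" "\<And>k. finite {i \<in> Idx M. d i = k}"
    "\<And>i. i \<in> Idx M \<Longrightarrow> top0 i \<noteq> 0 \<and> top1 i \<noteq> 0"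
    "\<And>i. i \<in> Idx M \<Longrightarrow>
       act M (K N0) i = Poly_Mapping.single i (top0 i * q powi (2 * int (d i)))"
    "\<And>i. i \<in> Idx M \<Longrightarrow>
       act M (K N1) i = Poly_Mapping.single i (top1 i * q powi (- 2 * int (d i)))"
  shows "M \<in> catO q"
  unfolding catO_def using assms by blast

lemma U_catO:
  assumes "s \<noteq> 0"
  shows "U s \<epsilon> p \<in> catO q"
proof -
  have "is_rep q (U s \<epsilon> p)"
    by (rule is_repI) (auto simp: U_def opr_def Let_def lin_single split: gen.splits node.splits if_splits)
  moreover have "sg \<epsilon> \<noteq> 0" by (cases \<epsilon>) auto
  ultimately show ?thesis using assms
    by (intro catO_I[of q _ "\<lambda>_. of_int (sg \<epsilon>) * s powi (- p)"
          "\<lambda>_. of_int (sg \<epsilon>) * s powi p" "\<lambda>_. 0"]) (auto simp: U_def)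
qed

lemma W1_catO:
  assumes "q \<noteq> 0" "s = - \<i> * q"
  shows "W1 s lam \<in> catO q"
proof -
  have s: "s \<noteq> 0" "q * q = - (s * s)" using assms by (auto simp: algebra_simps)
  have "is_rep q (W1 s lam)"
  proof (rule is_repI)
    fix i j k assume k: "k \<in> Idx (W1 s lam)"
    show "opr (W1 s lam) (K i) (act (W1 s lam) (E j) k)
        = smul (q powi acoeff i j) (opr (W1 s lam) (E j) (act (W1 s lam) (K i) k))"
      using k s
      by (cases i; cases j)
        (auto simp: W1_def opr_def lin_single power_int_minus field_simps power2_eq_square
          simp del: single_one)
  qed (auto simp: W1_def opr_def Let_def lin_single split: gen.splits node.splits if_splits)
  then show ?thesis using s
    by (intro catO_I[of q _ "\<lambda>i. if i = 0 then inverse s else - s"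
          "\<lambda>i. if i = 0 then s else - inverse s" "\<lambda>_. 0"]) (auto simp: W1_def)
qed

lemma osc_coeff_Suc:
  "osc_coeff q \<epsilon> (Suc k) = q powi sg \<epsilon> * osc_const q - (q powi sg \<epsilon>)\<^sup>2 * osc_coeff q \<epsilon> k"
  by (simp add: power_int_mult mult.commute[of 2])

lemma rho_act:
  "act (rho q \<epsilon> lam) (E N0) k = Poly_Mapping.single (Suc k) lam"
  "act (rho q \<epsilon> lam) (E N1) k = Poly_Mapping.single (k - 1) (lam * osc_coeff q (opp \<epsilon>) k)"
  "act (rho q \<epsilon> lam) (K N0) k = Poly_Mapping.single k ((q * q) ^ k)"
  "act (rho q \<epsilon> lam) (K N1) k = Poly_Mapping.single k (inverse ((q * q) ^ k))"
proof -
  have e: "q powi (2 * int k) = (q * q) ^ k" "q powi (- (2 * int k)) = inverse ((q * q) ^ k)"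
    by (simp_all add: power_int_minus power_int_mult power2_eq_square)
  show
    "act (rho q \<epsilon> lam) (E N0) k = Poly_Mapping.single (Suc k) lam"
    "act (rho q \<epsilon> lam) (E N1) k = Poly_Mapping.single (k - 1) (lam * osc_coeff q (opp \<epsilon>) k)"
    "act (rho q \<epsilon> lam) (K N0) k = Poly_Mapping.single k ((q * q) ^ k)"
    "act (rho q \<epsilon> lam) (K N1) k = Poly_Mapping.single k (inverse ((q * q) ^ k))"
    by (cases \<epsilon>; simp add: rho_def alpha_def H_eig_def e)+
qed

lemma rho_catO:
  assumes "q \<noteq> 0" "q + inverse q \<noteq> 0"
  shows "rho q \<epsilon> lam \<in> catO q"
proof -
  have Idx: "Idx (rho q \<epsilon> lam) = UNIV" and odd: "odd_idx (rho q \<epsilon> lam) = odd"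
    by (simp_all add: rho_def)
  have "is_rep q (rho q \<epsilon> lam)"
  proof (rule is_repI)
    fix g i assume "i \<in> Idx (rho q \<epsilon> lam)"
    show "Poly_Mapping.keys (act (rho q \<epsilon> lam) g i) \<subseteq> Idx (rho q \<epsilon> lam)"
      by (simp add: Idx)
  next
    fix n i j assume "j \<in> Poly_Mapping.keys (act (rho q \<epsilon> lam) (E n) i)"
    then show "odd_idx (rho q \<epsilon> lam) j \<noteq> odd_idx (rho q \<epsilon> lam) i"
      by (cases n; cases i) (auto simp: odd rho_act split: if_splits)
  next
    fix n i j assume "j \<in> Poly_Mapping.keys (act (rho q \<epsilon> lam) (K n) i)"
    then show "odd_idx (rho q \<epsilon> lam) j = odd_idx (rho q \<epsilon> lam) i"
      by (cases n) (auto simp: odd rho_act split: if_splits)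
  next
    fix i j k
    show "opr (rho q \<epsilon> lam) (K i) (act (rho q \<epsilon> lam) (E j) k)
        = smul (q powi acoeff i j) (opr (rho q \<epsilon> lam) (E j) (act (rho q \<epsilon> lam) (K i) k))"
      using assms
      by (cases i; cases j; cases k)
        (auto simp: rho_act opr_def lin_single power_int_minus
          field_simps power2_eq_square simp del: single_one osc_coeff.simps(2))
  next
    fix i j :: node and k assume ij: "i \<noteq> j"
    have t: "q * q + 1 \<noteq> 0" using assms by (auto simp: field_simps)
    define r where "r = q powi sg (opp \<epsilon>)"
    define C where "C = osc_const q"
    define c where "c = osc_coeff q (opp \<epsilon>)"
    define th where "th = three_q q"
    have c: "c 0 = 0" "\<And>k. c (Suc k) = r * C - r * r * c k"
      by (simp_all only: c_def r_def C_def osc_coeff_Suc osc_coeff.simps(1) power2_eq_square)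
    have r: "r \<noteq> 0" using assms by (simp add: r_def)
    have "th = q * q - 1 + inverse (q * q)"
      using assms(1) t unfolding th_def three_q_def by (simp add: divide_simps) (simp add: algebra_simps eval_nat_numeral)
    then have "th = r * r - 1 + inverse (r * r)"
      by (cases \<epsilon>) (simp_all add: r_def power_int_minus field_simps)
    then have th: "th * (r * r) = r * r * (r * r) - r * r + 1"
      using r by (simp add: field_simps)
    have act: "opr (rho q \<epsilon> lam) (E N1) = lin (\<lambda>k. Poly_Mapping.single (k - 1) (lam * c k))"
      "opr (rho q \<epsilon> lam) (E N0) = lin (\<lambda>k. Poly_Mapping.single (Suc k) lam)"
      "act (rho q \<epsilon> lam) (E N1) = (\<lambda>k. Poly_Mapping.single (k - 1) (lam * c k))"
      "act (rho q \<epsilon> lam) (E N0) = (\<lambda>k. Poly_Mapping.single (Suc k) lam)"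
      by (auto simp: fun_eq_iff rho_act opr_def c_def intro!: lin_cong)
    have S0: "c k + th * c (Suc k) - th * c (Suc (Suc k)) - c (Suc (Suc (Suc k))) = 0" for k
    proof -
      have "c k + th * c (Suc k) - th * c (Suc (Suc k)) - c (Suc (Suc (Suc k)))
          = (r * C - (1 + r * r) * c k) * (th * (r * r) - (r * r * (r * r) - r * r + 1))"
        unfolding c by (simp add: algebra_simps)
      then show ?thesis using th by simp
    qed
    show "let x = opr (rho q \<epsilon> lam) (E i); y = opr (rho q \<epsilon> lam) (E j);
         x' = act (rho q \<epsilon> lam) (E i) k; y' = act (rho q \<epsilon> lam) (E j) k in
           x (x (x y')) + smul (three_q q) (x (x (y x')))
             - smul (three_q q) (x (y (x x'))) - y (x (x x')) = 0"
    proof (cases i)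
      case N0
      then have j: "j = N1" using ij by (cases j) auto
      have "lam * lam * lam * lam *
          (c k + th * c (Suc k) - th * c (Suc (Suc k)) - c (Suc (Suc (Suc k)))) = 0"
        by (simp only: S0 mult_zero_right)
      then show ?thesis unfolding N0 j Let_def act th_def[symmetric]
        by (cases k) (simp_all add: lin_single c(1) algebra_simps del: single_one
            flip: single_add single_diff)
    next
      case N1
      then have j: "j = N0" using ij by (cases j) auto
      have S: "lam * lam * lam * lam * c (Suc (Suc m)) * c (Suc m) *
          (c m + th * c (Suc m) - th * c (Suc (Suc m)) - c (Suc (Suc (Suc m)))) = 0" for m
        by (simp only: S0 mult_zero_right)
      consider "k = 0" | "k = Suc 0" | m where "k = Suc (Suc m)"
        by (metis not0_implies_Suc)
      then show ?thesis
      proof cases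
        case 3
        show ?thesis using S[of m] unfolding N1 j Let_def act th_def[symmetric] 3
          by (cases m) (simp_all add: lin_single c(1) algebra_simps del: single_one
            flip: single_add single_diff)
      qed (simp_all add: N1 j Let_def act lin_single c(1) del: single_one)
    qed
  qed
  then show ?thesis using assms
    by (intro catO_I[of q _ "\<lambda>_. 1" "\<lambda>_. 1" "\<lambda>k. k"])
      (auto simp: Idx rho_act power_int_minus power_int_mult power2_eq_square)
qed

end

theory Submission
  imports Defs
begin

text \<open>In \<open>W\<^sub>1(\<lambda>) \<otimes> \<rho>\<^sub>\<plusminus>(\<lambda>)\<close> each weight space is spanned by \<open>v\<^sub>1\<^sub>/\<^sub>2 \<otimes> w\<^sub>k\<close> and
  \<open>v\<^sub>-\<^sub>1\<^sub>/\<^sub>2 \<otimes> w\<^sub>k\<^sub>-\<^sub>1\<close>. A suitable combination of the two spans, as \<open>k\<close> varies, a submodule that is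
  again a prefundamental module twisted by a character, with spectral parameter multiplied by
  \<open>q\<^sub>*\<close>; the quotient is of the same kind with parameter divided by \<open>q\<^sub>*\<close>. The resulting short exact
  sequence gives the relation for the additive classes, and the sign of the odd term is the sign of
  the bracket of the odd character. Products of classes can be computed on representatives because
  tensor products preserve category \<open>\<O>\<close> and short exact sequences.\<close>

section \<open>Tensor products of linear maps\<close>

text \<open>\<open>pre_groth q\<close> is not a ring, since the tensor product is associative and
  unital only up to isomorphism. So \<open>groth q\<close> is handled as an abelian group with a
  product of cosets; the one multiplicative fact behind it is that \<open>exact_rel q\<close>
  absorbs tensoring with category O. As \<open>q\<close> may be a root of unity, weights need not
  separate basis vectors and oscillator coefficients may vanish. Hence the submodules are given by
  explicit coefficients, dividing only by powers of \<open>q\<close> and by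
  \<open>q * q + 1\<close>. The shift by \<open>qs\<close> comes from
  \<open>qs * qs = - (q * q)\<close>: the product of the factors with which E_0 raises and E_1
  lowers changes by -q^2 on the submodule and by -q^(-2) on the quotient, and rescaling the basis
  spreads this evenly over both generators.\<close>

lemma lookup_vtensor:
  "Poly_Mapping.lookup (vtensor v w) k =
     Poly_Mapping.lookup v (fst (prod_decode k)) * Poly_Mapping.lookup w (snd (prod_decode k))"
proof -
  obtain a b where k: "k = prod_encode (a, b)"
    by (metis prod_decode_inverse surj_pair)
  have "Poly_Mapping.lookup (vtensor v w) k =
      (\<Sum>i\<in>Poly_Mapping.keys v. \<Sum>j\<in>Poly_Mapping.keys w.
         if i = a \<and> j = b then Poly_Mapping.lookup v i * Poly_Mapping.lookup w j else 0)"
    unfolding vtensor_def k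
    by (auto simp: lookup_sum lookup_single when_def prod_encode_eq intro!: sum.cong)
  also have "\<dots> = (\<Sum>i\<in>Poly_Mapping.keys v. if i = a then
      (\<Sum>j\<in>Poly_Mapping.keys w. if j = b then Poly_Mapping.lookup v i * Poly_Mapping.lookup w j else 0) else 0)"
    by (intro sum.cong) auto
  also have "\<dots> = Poly_Mapping.lookup v a * Poly_Mapping.lookup w b"
    by (simp add: in_keys_iff)
  finally show ?thesis by (simp add: k)
qed

lemma keys_vtensor:
  "Poly_Mapping.keys (vtensor v w) = prod_encode ` (Poly_Mapping.keys v \<times> Poly_Mapping.keys w)"
proof (intro subset_antisym subsetI)
  fix k assume "k \<in> Poly_Mapping.keys (vtensor v w)"
  then show "k \<in> prod_encode ` (Poly_Mapping.keys v \<times> Poly_Mapping.keys w)"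
    by (intro image_eqI[of _ _ "prod_decode k"])
      (auto simp: in_keys_iff lookup_vtensor mem_Times_iff)
qed (auto simp: in_keys_iff lookup_vtensor)

lemma vtensor_single [simp]:
  "vtensor (Poly_Mapping.single i a) (Poly_Mapping.single j b)
     = Poly_Mapping.single (prod_encode (i, j)) (a * b)"
proof (rule poly_mapping_eqI)
  fix k
  obtain i' j' where "k = prod_encode (i', j')"
    by (metis prod_decode_inverse surj_pair)
  then show "Poly_Mapping.lookup (vtensor (Poly_Mapping.single i a) (Poly_Mapping.single j b)) k
      = Poly_Mapping.lookup (Poly_Mapping.single (prod_encode (i, j)) (a * b)) k"
    by (simp add: lookup_vtensor lookup_single when_def prod_encode_eq)
qed

lemma vtensor_zero [simp]: "vtensor 0 w = 0" "vtensor v 0 = 0"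
  by (simp_all add: vtensor_def)

lemma vtensor_add:
  "vtensor (v + v') w = vtensor v w + vtensor v' w"
  "vtensor v (w + w') = vtensor v w + vtensor v w'"
  by (rule poly_mapping_eqI, simp add: lookup_vtensor lookup_add algebra_simps)+

lemma vtensor_diff:
  "vtensor (v - v') w = vtensor v w - vtensor v' w"
  "vtensor v (w - w') = vtensor v w - vtensor v w'"
  by (rule poly_mapping_eqI, simp add: lookup_vtensor lookup_minus algebra_simps)+

lemma vtensor_smul:
  "vtensor (smul c v) w = smul c (vtensor v w)"
  "vtensor v (smul c w) = smul c (vtensor v w)"
  by (rule poly_mapping_eqI, simp add: lookup_vtensor)+

lemma vtensor_sum:
  "vtensor (sum f A) w = (\<Sum>i\<in>A. vtensor (f i) w)"
  "vtensor v (sum g A) = (\<Sum>i\<in>A. vtensor v (g i))"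
  by (induction A rule: infinite_finite_induct) (simp_all add: vtensor_add)

lemma smul_one [simp]: "smul 1 v = v"
  by (rule poly_mapping_eqI) simp

abbreviation basis :: "nat \<Rightarrow> vec" where
  "basis i \<equiv> Poly_Mapping.single i 1"

lemma lin_basis [simp]: "lin basis v = v"
  by (rule poly_mapping_eqI)
    (auto simp: lin_def lookup_sum lookup_single when_def in_keys_iff)

lemma lin_of_basis [simp]: "lin F (basis i) = F i"
  by (simp add: lin_single)

lemma lin_diff: "lin F (v - w) = lin F v - lin F w"
  using lin_add[of F "v - w" w] by simp

lemma keys_lin:
  assumes "Poly_Mapping.keys v \<subseteq> I" "\<And>i. i \<in> I \<Longrightarrow> Poly_Mapping.keys (F i) \<subseteq> J"
  shows "Poly_Mapping.keys (lin F v) \<subseteq> J"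
proof -
  have "Poly_Mapping.keys (smul c w) \<subseteq> Poly_Mapping.keys w" for c w
    by (auto simp: in_keys_iff)
  then show ?thesis unfolding lin_def using assms
    by (intro order.trans[OF Poly_Mapping.keys_sum] UN_least) blast
qed

text \<open>The tensor product of the linear maps given by \<open>F\<close> and \<open>G\<close>, without any sign.\<close>

definition tmap :: "(nat \<Rightarrow> vec) \<Rightarrow> (nat \<Rightarrow> vec) \<Rightarrow> nat \<Rightarrow> vec" where
  "tmap F G k = (case prod_decode k of (i, j) \<Rightarrow> vtensor (F i) (G j))"

lemma tmap_encode [simp]: "tmap F G (prod_encode (i, j)) = vtensor (F i) (G j)"
  by (simp add: tmap_def)

lemma lin_tmap: "lin (tmap F G) (vtensor v w) = vtensor (lin F v) (lin G w)"
proof -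
  have "lin (tmap F G) (vtensor v w) = (\<Sum>(i, j)\<in>Poly_Mapping.keys v \<times> Poly_Mapping.keys w.
      smul (Poly_Mapping.lookup v i * Poly_Mapping.lookup w j) (vtensor (F i) (G j)))"
    unfolding lin_def keys_vtensor
    by (subst sum.reindex) (auto simp: lookup_vtensor inj_prod_encode intro!: sum.cong)
  also have "\<dots> = vtensor (lin F v) (lin G w)"
    by (subst sum.cartesian_product[symmetric], subst sum.swap)
      (simp add: lin_def vtensor_sum vtensor_smul smul_simps smul_sum mult.commute)
  finally show ?thesis .
qed

section \<open>Generators on a tensor product as sums of unsigned tensor maps\<close>

lemma Idx_tensor [simp]: "Idx (tensor M N) = prod_encode ` (Idx M \<times> Idx N)"
  and odd_tensor [simp]: "odd_idx (tensor M N) (prod_encode (i, j)) \<longleftrightarrow> odd_idx M i \<noteq> odd_idx N j"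
  by (simp_all add: tensor_def)

text \<open>The super sign in the action of 1 \<otimes> E, made an operator on the first factor;
  this turns 1 \<otimes> E into an ordinary tensor product of linear maps, to which
  \<open>lin_tmap\<close> applies.\<close>

definition parity :: "srep \<Rightarrow> nat \<Rightarrow> vec" where
  "parity M i = Poly_Mapping.single i (if odd_idx M i then - 1 else 1)"

lemma act_tensor_E:
  "act (tensor M N) (E n) k = tmap (act M (E n)) (act N (K n)) k + tmap (parity M) (act N (E n)) k"
proof -
  have parity: "parity M = (\<lambda>i. smul (if odd_idx M i then - 1 else 1) (basis i))"
    by (simp add: parity_def fun_eq_iff)
  show ?thesis unfolding parity
    by (simp add: tensor_def tmap_def vtensor_smul del: smul_single split: prod.split)
qed

lemma act_tensor_K: "act (tensor M N) (K n) k = tmap (act M (K n)) (act N (K n)) k"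
  by (simp add: tensor_def tmap_def split: prod.split)

lemma lin_parity:
  assumes "\<And>j. j \<in> Poly_Mapping.keys v \<Longrightarrow> odd_idx M j = e"
  shows "lin (parity M) v = smul (if e then - 1 else 1) v"
proof -
  have "lin (parity M) v = lin (\<lambda>i. smul (if e then - 1 else 1) (basis i)) v"
    using assms by (intro lin_cong) (auto simp: parity_def)
  also have "\<dots> = smul (if e then - 1 else 1) v"
    by (simp only: lin_basis flip: smul_lin)
  finally show ?thesis .
qed

lemma opr_tensor_E:
  "opr (tensor M N) (E n) v = lin (tmap (act M (E n)) (act N (K n))) v + lin (tmap (parity M) (act N (E n))) v"
  unfolding opr_def lin_plus by (rule lin_cong) (rule act_tensor_E)

lemma opr_tensor_K:
  "opr (tensor M N) (K n) v = lin (tmap (act M (K n)) (act N (K n))) v"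
  unfolding opr_def by (rule lin_cong) (rule act_tensor_K)

text \<open>With \<open>p = - q\<^sup>2\<close> the super Serre relation is the ordinary one for \<open>p\<close>, since
  \<open>three_q q = - (p + 1 + p\<^sup>-\<^sup>1)\<close>; all mixed terms cancel by \<open>p\<close>-commutation. The maps \<open>a, c\<close> stand
  for \<open>E\<^sub>i \<otimes> K\<^sub>i, E\<^sub>j \<otimes> K\<^sub>j\<close> and \<open>b, d\<close> for \<open>1 \<otimes> E\<^sub>i, 1 \<otimes> E\<^sub>j\<close>.\<close>

lemma serre_sum:
  fixes p r th :: complex
  assumes p: "p * r = 1" and th: "th = - (p + 1 + r)"
    and cl: "\<And>u. u \<in> V \<Longrightarrow> lin a u \<in> V" "\<And>u. u \<in> V \<Longrightarrow> lin b u \<in> V"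
      "\<And>u. u \<in> V \<Longrightarrow> lin c u \<in> V" "\<And>u. u \<in> V \<Longrightarrow> lin d u \<in> V"
    and ab: "\<And>u. u \<in> V \<Longrightarrow> lin a (lin b u) = smul p (lin b (lin a u))"
    and ad: "\<And>u. u \<in> V \<Longrightarrow> lin a (lin d u) = smul r (lin d (lin a u))"
    and cb: "\<And>u. u \<in> V \<Longrightarrow> lin c (lin b u) = smul r (lin b (lin c u))"
    and ac: "lin a (lin a (lin a (lin c v))) + smul th (lin a (lin a (lin c (lin a v))))
             - smul th (lin a (lin c (lin a (lin a v)))) - lin c (lin a (lin a (lin a v))) = 0"
    and bd: "lin b (lin b (lin b (lin d v))) + smul th (lin b (lin b (lin d (lin b v))))
             - smul th (lin b (lin d (lin b (lin b v)))) - lin d (lin b (lin b (lin b v))) = 0"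
    and v: "v \<in> V"
    and x: "x = (\<lambda>u. lin a u + lin b u)" and y: "y = (\<lambda>u. lin c u + lin d u)"
  shows "x (x (x (y v))) + smul th (x (x (y (x v)))) - smul th (x (y (x (x v)))) - y (x (x (x v))) = 0"
proof (rule poly_mapping_eqI)
  fix i
  have pr: "p * (r * z) = z" for z using p by (simp flip: mult.assoc)
  \<comment> \<open>Reading off one coordinate turns the claim into an identity of complex numbers,
    which \<open>algebra_simps\<close> can normalise.\<close>
  define h where "h = (\<lambda>w :: vec. Poly_Mapping.lookup w i)"
  have h: "h (u + w) = h u + h w" "h (u - w) = h u - h w" "h (smul t u) = t * h u" "h 0 = 0" for u w t
    by (simp_all add: h_def lookup_add lookup_minus)
  have e: "h (lin a (lin a (lin a (lin c v)))) = th * h (lin a (lin c (lin a (lin a v))))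
        + h (lin c (lin a (lin a (lin a v)))) - th * h (lin a (lin a (lin c (lin a v))))"
      "h (lin b (lin b (lin b (lin d v)))) = th * h (lin b (lin d (lin b (lin b v))))
        + h (lin d (lin b (lin b (lin b v)))) - th * h (lin b (lin b (lin d (lin b v))))"
    using arg_cong[OF ac, of h] arg_cong[OF bd, of h] by (simp_all add: h algebra_simps)
  \<comment> \<open>The rules \<open>ab\<close>, \<open>ad\<close>, \<open>cb\<close> move
    \<open>b\<close> and \<open>d\<close> to the left of \<open>a\<close> and \<open>c\<close>, and
    \<open>e\<close> removes the pure words. The coefficient of each remaining mixed word is a
    polynomial in \<open>p\<close>, \<open>r\<close> and \<open>th\<close> that vanishes for the
    given \<open>th\<close>.\<close>
  have "h (x (x (x (y v))) + smul th (x (x (y (x v)))) - smul th (x (y (x (x v)))) - y (x (x (x v)))) = 0"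
    unfolding x y
    by (simp add: h lin_add lin_smul v cl ab ad cb e) (simp add: th algebra_simps p pr)
  then show "Poly_Mapping.lookup (x (x (x (y v))) + smul th (x (x (y (x v)))) - smul th (x (y (x (x v))))
      - y (x (x (x v)))) i = Poly_Mapping.lookup 0 i"
    by (simp add: h_def)
qed

section \<open>Tensor products in category \<open>\<O>\<close>\<close>

lemma catO_is_rep: "M \<in> catO q \<Longrightarrow> is_rep q M"
  by (simp add: catO_def)

lemma catO_weights:
  assumes "M \<in> catO q"
  obtains \<kappa> where "\<And>n i. i \<in> Idx M \<Longrightarrow> act M (K n) i = smul (\<kappa> n i) (basis i)"
proof -
  have "\<exists>\<kappa>. i \<in> Idx M \<longrightarrow> act M (K n) i = smul \<kappa> (basis i)" for n i
    using assms by (cases n) (auto simp: catO_def)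
  then have "\<exists>\<kappa>. \<forall>n i. i \<in> Idx M \<longrightarrow> act M (K n) i = smul (\<kappa> n i) (basis i)"
    by (intro choice allI)
  then show ?thesis using that by blast
qed

lemma is_rep_keys:
  assumes "is_rep q M" "i \<in> Idx M"
  shows "Poly_Mapping.keys (act M g i) \<subseteq> Idx M"
  using assms by (auto simp: is_rep_def)

lemma is_rep_odd_E:
  assumes "is_rep q M" "i \<in> Idx M" "j \<in> Poly_Mapping.keys (act M (E n) i)"
  shows "odd_idx M j \<longleftrightarrow> \<not> odd_idx M i"
  using assms unfolding is_rep_def by metis

lemma is_rep_odd_K:
  assumes "is_rep q M" "i \<in> Idx M" "j \<in> Poly_Mapping.keys (act M (K n) i)"
  shows "odd_idx M j \<longleftrightarrow> odd_idx M i"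
  using assms unfolding is_rep_def by metis

lemma basis_vspace [simp]: "basis i \<in> vspace M \<longleftrightarrow> i \<in> Idx M"
  by (simp add: vspace_def)

lemma is_rep_KE:
  assumes "is_rep q M" "i \<in> Idx M"
  shows "lin (act M (K m)) (act M (E n) i) = smul (q powi acoeff m n) (lin (act M (E n)) (act M (K m) i))"
proof -
  have "opr M (K m) (opr M (E n) (basis i)) = smul (q powi acoeff m n) (opr M (E n) (opr M (K m) (basis i)))"
    using assms unfolding is_rep_def by (meson basis_vspace)
  then show ?thesis by (simp only: opr_def lin_of_basis)
qed

lemma is_rep_serre:
  assumes "is_rep q M" "k \<in> Idx M" "i \<noteq> j"
  shows "let x = lin (act M (E i)); y = lin (act M (E j)) in
           x (x (x (act M (E j) k))) + smul (three_q q) (x (x (y (act M (E i) k))))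
             - smul (three_q q) (x (y (x (act M (E i) k)))) - y (x (x (act M (E i) k))) = 0"
proof -
  have "let x = opr M (E i); y = opr M (E j) in
           x (x (x (y (basis k)))) + smul (three_q q) (x (x (y (x (basis k)))))
             - smul (three_q q) (x (y (x (x (basis k))))) - y (x (x (x (basis k)))) = 0"
    using assms unfolding is_rep_def by (meson basis_vspace)
  then show ?thesis by (simp only: opr_def lin_of_basis Let_def)
qed

lemma lin_eqI:
  assumes "\<And>i. i \<in> Poly_Mapping.keys v \<Longrightarrow> lin F (G i) = smul c (lin F' (G' i))"
  shows "lin F (lin G v) = smul c (lin F' (lin G' v))"
  unfolding lin_lin smul_lin using assms by (intro lin_cong) (simp add: smul_lin lin_lin)

lemma three_q_eq:
  assumes "q \<noteq> 0" "q + inverse q \<noteq> 0"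
  shows "three_q q = - (- (q powi 2) + 1 + - (q powi (- 2)))"
proof -
  have "q * q + 1 \<noteq> 0" using assms by (auto simp: field_simps)
  then show ?thesis using assms(1)
    by (simp add: three_q_def power_int_minus power2_eq_square divide_simps)
      (simp add: algebra_simps eval_nat_numeral)
qed

text \<open>E_n acts as the sum of E \<otimes> K and the signed 1 \<otimes> E, so
  \<open>serre_sum\<close> applies with p = -q^2. Category O enters through the diagonal action of
  the K: \<open>is_rep\<close> does not state that they commute, but their eigenvalues can be pulled
  out of every word.\<close>

lemma tensor_is_rep:
  assumes q: "q \<noteq> 0" "q + inverse q \<noteq> 0" and M: "M \<in> catO q" and N: "N \<in> catO q"
  shows "is_rep q (tensor M N)"
proof -
  note rM = catO_is_rep[OF M] and rN = catO_is_rep[OF N]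
  obtain \<kappa> where \<kappa>: "\<And>n i. i \<in> Idx M \<Longrightarrow> act M (K n) i = smul (\<kappa> n i) (basis i)"
    using catO_weights[OF M] by metis
  obtain \<mu> where \<mu>: "\<And>n i. i \<in> Idx N \<Longrightarrow> act N (K n) i = smul (\<mu> n i) (basis i)"
    using catO_weights[OF N] by metis
  define T where "T = tensor M N"
  define a where "a n = tmap (act M (E n)) (act N (K n))" for n
  define b where "b n = tmap (parity M) (act N (E n))" for n
  define kk where "kk n = tmap (act M (K n)) (act N (K n))" for n
  define sgn where "sgn i = (if odd_idx M i then - 1 else (1 :: complex))" for i
  have actE: "act T (E n) k = a n k + b n k" and actK: "act T (K n) k = kk n k" for n k
    by (simp_all add: T_def a_def b_def kk_def act_tensor_E act_tensor_K)
  have oprE: "opr T (E n) = (\<lambda>u. lin (a n) u + lin (b n) u)"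
    and oprK: "opr T (K n) = lin (kk n)" for n
    by (auto simp: fun_eq_iff T_def a_def b_def kk_def opr_tensor_E opr_tensor_K)
  have Idx: "Idx T = prod_encode ` (Idx M \<times> Idx N)"
    by (simp add: T_def)
  have oddT: "odd_idx T (prod_encode (i, j)) \<longleftrightarrow> odd_idx M i \<noteq> odd_idx N j" for i j
    by (simp add: T_def)
  have IdxE: thesis if "k \<in> Idx T"
    "\<And>i j. k = prod_encode (i, j) \<Longrightarrow> i \<in> Idx M \<Longrightarrow> j \<in> Idx N \<Longrightarrow> thesis" for k thesis
    using that by (auto simp: Idx)
  have par: "parity M i = smul (sgn i) (basis i)" for i
    by (simp add: parity_def sgn_def)
  \<comment> \<open>E is odd, so it anticommutes with the parity operator; this is the source of the
    minus sign in \<open>ab\<close>.\<close>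
  have parE: "lin (parity M) (act M (E n) i) = smul (- sgn i) (act M (E n) i)" if "i \<in> Idx M" for n i
    using lin_parity[of "act M (E n) i" M "\<not> odd_idx M i"] is_rep_odd_E[OF rM that]
    by (auto simp: sgn_def)
  have keys: "Poly_Mapping.keys (a n k) \<subseteq> Idx T" "Poly_Mapping.keys (b n k) \<subseteq> Idx T"
    "Poly_Mapping.keys (kk n k) \<subseteq> Idx T" if "k \<in> Idx T" for n k
    using that is_rep_keys[OF rM] is_rep_keys[OF rN]
    by (auto simp: Idx a_def b_def kk_def keys_vtensor parity_def image_iff split: if_splits; blast)+
  have cl: "lin (a n) u \<in> vspace T" "lin (b n) u \<in> vspace T" if "u \<in> vspace T" for n u
    using that keys(1,2) keys_lin[of u "Idx T" _ "Idx T"] by (simp_all add: vspace_def)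
  have ab: "lin (a m) (lin (b n) u) = smul (- (q powi acoeff m n)) (lin (b n) (lin (a m) u))"
    if u: "u \<in> vspace T" for m n u
  proof (rule lin_eqI)
    fix k assume "k \<in> Poly_Mapping.keys u"
    then have "k \<in> Idx T" using u by (auto simp: vspace_def)
    then show "lin (a m) (b n k) = smul (- (q powi acoeff m n)) (lin (b n) (a m k))"
    proof (rule IdxE)
      fix i j assume "k = prod_encode (i, j)" "i \<in> Idx M" "j \<in> Idx N"
      then show ?thesis
        by (simp add: a_def b_def lin_tmap par lin_smul parE is_rep_KE[OF rN] vtensor_smul smul_simps mult.commute
            del: acoeff.simps smul_single)
    qed
  qed
  \<comment> \<open>In the second factor all four words act by the same scalar, the cube of the
    eigenvalue of K_i times that of K_j.\<close>
  have serre_a: "lin (a i) (lin (a i) (lin (a i) (lin (a j) (basis k))))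
      + smul (three_q q) (lin (a i) (lin (a i) (lin (a j) (lin (a i) (basis k)))))
      - smul (three_q q) (lin (a i) (lin (a j) (lin (a i) (lin (a i) (basis k)))))
      - lin (a j) (lin (a i) (lin (a i) (lin (a i) (basis k)))) = 0"
    if ij: "i \<noteq> j" and k: "k \<in> Idx T" for i j k
    using k
  proof (rule IdxE)
    fix m n assume "k = prod_encode (m, n)" and m: "m \<in> Idx M" and n: "n \<in> Idx N"
    then show ?thesis
      using arg_cong[OF is_rep_serre[OF rM m ij, unfolded Let_def],
          of "\<lambda>w. smul (\<mu> i n * \<mu> i n * \<mu> i n * \<mu> j n) (vtensor w (basis n))"]
      by (simp add: a_def lin_tmap \<mu> lin_smul smul_simps vtensor_smul vtensor_add vtensor_diff ac_simps
          del: smul_single)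
  qed
  \<comment> \<open>The sign of the first factor occurs four times in every word and
    cancels.\<close>
  have serre_b: "lin (b i) (lin (b i) (lin (b i) (lin (b j) (basis k))))
      + smul (three_q q) (lin (b i) (lin (b i) (lin (b j) (lin (b i) (basis k)))))
      - smul (three_q q) (lin (b i) (lin (b j) (lin (b i) (lin (b i) (basis k)))))
      - lin (b j) (lin (b i) (lin (b i) (lin (b i) (basis k)))) = 0"
    if ij: "i \<noteq> j" and k: "k \<in> Idx T" for i j k
    using k
  proof (rule IdxE)
    fix m n assume "k = prod_encode (m, n)" and m: "m \<in> Idx M" and n: "n \<in> Idx N"
    then show ?thesis
      using arg_cong[OF is_rep_serre[OF rN n ij, unfolded Let_def], of "vtensor (basis m)"]
      by (simp add: b_def lin_tmap par lin_smul smul_simps vtensor_smul vtensor_add vtensor_diff sgn_def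
          del: smul_single)
  qed
  have "is_rep q T"
  proof (rule is_repI)
    fix g k assume "k \<in> Idx T"
    then show "Poly_Mapping.keys (act T g k) \<subseteq> Idx T"
      using keys Poly_Mapping.keys_add[of "a n k" "b n k" for n]
      by (cases g) (fastforce simp: actE actK)+
  next
    fix n k l assume k: "k \<in> Idx T" and l: "l \<in> Poly_Mapping.keys (act T (E n) k)"
    from k show "odd_idx T l \<noteq> odd_idx T k"
    proof (rule IdxE)
      fix i j assume ij: "k = prod_encode (i, j)" "i \<in> Idx M" "j \<in> Idx N"
      then have "l \<in> Poly_Mapping.keys (a n k) \<or> l \<in> Poly_Mapping.keys (b n k)"
        using l Poly_Mapping.keys_add[of "a n k" "b n k"] by (auto simp: actE)
      then show ?thesis using ij is_rep_odd_E[OF rM] is_rep_odd_E[OF rN] is_rep_odd_K[OF rN]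
        by (auto simp: oddT a_def b_def keys_vtensor parity_def split: if_splits)
    qed
  next
    fix n k l assume k: "k \<in> Idx T" and l: "l \<in> Poly_Mapping.keys (act T (K n) k)"
    from k show "odd_idx T l = odd_idx T k"
    proof (rule IdxE)
      fix i j assume "k = prod_encode (i, j)" "i \<in> Idx M" "j \<in> Idx N"
      then show ?thesis using l is_rep_odd_K[OF rM] is_rep_odd_K[OF rN]
        by (auto simp: actK kk_def keys_vtensor oddT)
    qed
  next
    fix m n k assume "k \<in> Idx T"
    then show "opr T (K m) (act T (E n) k) = smul (q powi acoeff m n) (opr T (E n) (act T (K m) k))"
    proof (rule IdxE)
      fix i j assume "k = prod_encode (i, j)" "i \<in> Idx M" "j \<in> Idx N"
      then show ?thesis
        by (simp add: oprK oprE actE actK a_def b_def kk_def lin_add lin_tmap is_rep_KE[OF rM] is_rep_KE[OF rN]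
            \<mu> \<kappa> par lin_smul vtensor_smul smul_simps ac_simps
            del: acoeff.simps smul_single)
    qed
  next
    fix i j k assume k: "k \<in> Idx T" and ij: "i \<noteq> (j :: node)"
    have ac: "acoeff i i = 2" "acoeff i j = -2" "acoeff j i = -2" using ij by auto
    show "let x = opr T (E i); y = opr T (E j); x' = act T (E i) k; y' = act T (E j) k in
           x (x (x y')) + smul (three_q q) (x (x (y x')))
             - smul (three_q q) (x (y (x x'))) - y (x (x x')) = 0"
      using serre_sum[OF _ three_q_eq[OF q] cl(1) cl(2) cl(1) cl(2)
          ab[of _ i i, unfolded ac] ab[of _ i j, unfolded ac] ab[of _ j i, unfolded ac]
          serre_a[OF ij k] serre_b[OF ij k] _ refl refl] k q(1)
      by (simp add: Let_def oprE actE power_int_minus)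
  qed
  then show ?thesis by (simp add: T_def)
qed

text \<open>Tops of cones multiply and depths add. Depth \<open>k\<close> is therefore reached only
  from depths at most \<open>k\<close> in the two factors, which leaves finitely many pairs of basis
  vectors.\<close>

lemma tensor_catO:
  assumes q: "q \<noteq> 0" "q + inverse q \<noteq> 0" and M: "M \<in> catO q" and N: "N \<in> catO q"
  shows "tensor M N \<in> catO q"
proof -
  from M obtain t0 t1 and d :: "nat \<Rightarrow> nat" where
    m: "finite ((\<lambda>i. (t0 i, t1 i)) ` Idx M)" "\<And>k. finite {i \<in> Idx M. d i = k}"
    "\<And>i. i \<in> Idx M \<Longrightarrow> t0 i \<noteq> 0 \<and> t1 i \<noteq> 0 \<and>
           act M (K N0) i = Poly_Mapping.single i (t0 i * q powi (2 * int (d i))) \<and>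
           act M (K N1) i = Poly_Mapping.single i (t1 i * q powi (- 2 * int (d i)))"
    unfolding catO_def by blast
  from N obtain u0 u1 and e :: "nat \<Rightarrow> nat" where
    n: "finite ((\<lambda>i. (u0 i, u1 i)) ` Idx N)" "\<And>k. finite {i \<in> Idx N. e i = k}"
    "\<And>i. i \<in> Idx N \<Longrightarrow> u0 i \<noteq> 0 \<and> u1 i \<noteq> 0 \<and>
           act N (K N0) i = Poly_Mapping.single i (u0 i * q powi (2 * int (e i))) \<and>
           act N (K N1) i = Poly_Mapping.single i (u1 i * q powi (- 2 * int (e i)))"
    unfolding catO_def by blast
  have e: "q powi (2 * int x + 2 * int y) = q powi (2 * int x) * q powi (2 * int y)"
    "q powi (- (2 * int x) - 2 * int y) = q powi (- (2 * int x)) * q powi (- (2 * int y))" for x y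
    using power_int_add[of q "2 * int x" "2 * int y"] power_int_add[of q "- (2 * int x)" "- (2 * int y)"] q(1)
    by simp_all
  let ?f = "\<lambda>k. fst (prod_decode k)" and ?s = "\<lambda>k. snd (prod_decode k)"
  show ?thesis
  proof (rule catO_I[of q _ "\<lambda>k. t0 (?f k) * u0 (?s k)" "\<lambda>k. t1 (?f k) * u1 (?s k)"
        "\<lambda>k. d (?f k) + e (?s k)"])
    show "is_rep q (tensor M N)" by (rule tensor_is_rep[OF assms])
    have "(\<lambda>k. (t0 (?f k) * u0 (?s k), t1 (?f k) * u1 (?s k))) ` Idx (tensor M N)
      \<subseteq> (\<lambda>((a, b), (c, d)). (a * c, b * d)) `
          (((\<lambda>i. (t0 i, t1 i)) ` Idx M) \<times> ((\<lambda>i. (u0 i, u1 i)) ` Idx N))"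
      by (force simp: image_iff)
    then show "finite ((\<lambda>k. (t0 (?f k) * u0 (?s k), t1 (?f k) * u1 (?s k))) ` Idx (tensor M N))"
      by (rule finite_subset[OF _ finite_imageI[OF finite_cartesian_product[OF m(1) n(1)]]])
    fix k
    have "{i \<in> Idx (tensor M N). d (?f i) + e (?s i) = k} \<subseteq>
        prod_encode ` ((\<Union>l\<le>k. {i \<in> Idx M. d i = l}) \<times> (\<Union>l\<le>k. {i \<in> Idx N. e i = l}))"
      by (auto simp: image_iff)
    then show "finite {i \<in> Idx (tensor M N). d (?f i) + e (?s i) = k}"
      by (rule finite_subset) (use m(2) n(2) in auto)
  qed (use m(3) n(3) q in \<open>auto simp: act_tensor_K distrib_left e ac_simps\<close>)
qed

section \<open>Exactness of the tensor product\<close>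

text \<open>Every short exact sequence splits as a sequence of vector spaces; the splitting maps \<open>R\<close>, \<open>S\<close>
  reduce exactness to identities on basis vectors.\<close>

definition split_exact ::
  "srep \<Rightarrow> srep \<Rightarrow> srep \<Rightarrow> (nat \<Rightarrow> vec) \<Rightarrow> (nat \<Rightarrow> vec) \<Rightarrow> (nat \<Rightarrow> vec) \<Rightarrow> (nat \<Rightarrow> vec) \<Rightarrow> bool" where
  "split_exact A B C F G R S \<longleftrightarrow> is_hom A B F \<and> is_hom B C G \<and>
     (\<forall>i\<in>Idx B. Poly_Mapping.keys (R i) \<subseteq> Idx A) \<and> (\<forall>i\<in>Idx C. Poly_Mapping.keys (S i) \<subseteq> Idx B) \<and>
     (\<forall>i\<in>Idx A. lin R (F i) = basis i) \<and> (\<forall>i\<in>Idx C. lin G (S i) = basis i) \<and>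
     (\<forall>i\<in>Idx A. lin G (F i) = 0) \<and> (\<forall>i\<in>Idx B. lin F (R i) + lin S (G i) = basis i)"

lemma lin_inverse:
  assumes "v \<in> vspace A" "\<And>i. i \<in> Idx A \<Longrightarrow> lin R (F i) = basis i"
  shows "lin R (lin F v) = v"
proof -
  have "lin R (lin F v) = lin basis v"
    unfolding lin_lin using assms by (intro lin_cong) (auto simp: vspace_def)
  then show ?thesis by simp
qed

lemma lin_vspace:
  assumes "v \<in> vspace A" "\<And>i. i \<in> Idx A \<Longrightarrow> Poly_Mapping.keys (F i) \<subseteq> Idx B"
  shows "lin F v \<in> vspace B"
  using assms keys_lin[of v "Idx A" F "Idx B"] by (simp add: vspace_def)

lemma is_hom_keys: "is_hom M N F \<Longrightarrow> i \<in> Idx M \<Longrightarrow> Poly_Mapping.keys (F i) \<subseteq> Idx N"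
  by (simp add: is_hom_def)

lemma is_homI:
  assumes "\<And>i. i \<in> Idx M \<Longrightarrow> Poly_Mapping.keys (F i) \<subseteq> Idx N"
    and "\<And>i j. i \<in> Idx M \<Longrightarrow> j \<in> Poly_Mapping.keys (F i) \<Longrightarrow> odd_idx N j = odd_idx M i"
    and "\<And>g i. i \<in> Idx M \<Longrightarrow> lin F (act M g i) = opr N g (F i)"
  shows "is_hom M N F"
proof -
  have "lin F (opr M g v) = opr N g (lin F v)" if "v \<in> vspace M" for g v
    using that assms(3) unfolding opr_def lin_lin by (intro lin_cong) (auto simp: vspace_def)
  then show ?thesis using assms(1,2) by (simp add: is_hom_def)
qed

lemma is_hom_act:
  assumes "is_hom M N F" "i \<in> Idx M"
  shows "lin F (act M g i) = lin (act N g) (F i)"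
proof -
  have "basis i \<in> vspace M" using assms(2) by (simp add: vspace_def)
  then have "lin F (opr M g (basis i)) = opr N g (lin F (basis i))"
    using assms(1) unfolding is_hom_def by blast
  then show ?thesis by (simp only: opr_def lin_of_basis)
qed

lemma split_exact_imp_short_exact:
  assumes "split_exact A B C F G R S"
  shows "short_exact A B C"
proof -
  have hF: "is_hom A B F" and hG: "is_hom B C G"
    and R: "\<And>i. i \<in> Idx B \<Longrightarrow> Poly_Mapping.keys (R i) \<subseteq> Idx A"
    and S: "\<And>i. i \<in> Idx C \<Longrightarrow> Poly_Mapping.keys (S i) \<subseteq> Idx B"
    and RF: "\<And>i. i \<in> Idx A \<Longrightarrow> lin R (F i) = basis i"
    and GS: "\<And>i. i \<in> Idx C \<Longrightarrow> lin G (S i) = basis i"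
    and GF: "\<And>i. i \<in> Idx A \<Longrightarrow> lin G (F i) = 0"
    and id: "\<And>i. i \<in> Idx B \<Longrightarrow> lin F (R i) + lin S (G i) = basis i"
    using assms unfolding split_exact_def by blast+
  have id': "lin F (lin R v) + lin S (lin G v) = v" if "v \<in> vspace B" for v
  proof -
    have "lin F (lin R v) + lin S (lin G v) = lin basis v"
      unfolding lin_lin lin_plus using that id by (intro lin_cong) (auto simp: vspace_def)
    then show ?thesis by simp
  qed
  have GF': "lin G (lin F v) = 0" if "v \<in> vspace A" for v
    unfolding lin_lin by (rule lin_0) (use that GF in \<open>auto simp: vspace_def\<close>)
  have "inj_on (lin F) (vspace A)"
    by (rule inj_on_inverseI[of _ "lin R"]) (rule lin_inverse[OF _ RF])
  moreover have "{v \<in> vspace B. lin G v = 0} = lin F ` vspace A"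
  proof (intro subset_antisym subsetI)
    fix v assume "v \<in> {v \<in> vspace B. lin G v = 0}"
    then have v: "v \<in> vspace B" "lin G v = 0" by auto
    then have "v = lin F (lin R v)" using id'[OF v(1)] by simp
    moreover have "lin R v \<in> vspace A" by (rule lin_vspace[OF v(1) R])
    ultimately show "v \<in> lin F ` vspace A" by (rule image_eqI)
  qed (use GF' lin_vspace[OF _ is_hom_keys[OF hF]] in auto)
  moreover have "lin G ` vspace B = vspace C"
  proof (intro subset_antisym subsetI)
    fix v assume v: "v \<in> vspace C"
    have "v = lin G (lin S v)" by (simp add: lin_inverse[OF v GS])
    moreover have "lin S v \<in> vspace B" by (rule lin_vspace[OF v S])
    ultimately show "v \<in> lin G ` vspace B" by (rule image_eqI)
  qed (use lin_vspace[OF _ is_hom_keys[OF hG]] in auto)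
  ultimately show ?thesis using hF hG unfolding short_exact_def by blast
qed

text \<open>\<open>S\<close> picks preimages of the basis vectors of \<open>C\<close>. Then
  \<open>basis i - lin S (G i)\<close> lies in the kernel of \<open>G\<close>, and
  \<open>R i\<close> is its preimage under \<open>F\<close>. That \<open>R\<close> inverts
  \<open>F\<close> on the left is checked after applying the injective \<open>F\<close>.\<close>

lemma short_exact_imp_split_exact:
  assumes "short_exact A B C"
  obtains F G R S where "split_exact A B C F G R S"
proof -
  from assms obtain F G where hF: "is_hom A B F" and hG: "is_hom B C G"
    and inj: "inj_on (lin F) (vspace A)"
    and ker: "{v \<in> vspace B. lin G v = 0} = lin F ` vspace A"
    and surj: "lin G ` vspace B = vspace C"
    unfolding short_exact_def by blast
  have mem: "basis i \<in> vspace M \<longleftrightarrow> i \<in> Idx M" for i M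
    by (simp add: vspace_def)
  have "\<forall>i\<in>Idx C. \<exists>v. v \<in> vspace B \<and> lin G v = basis i"
    using surj mem by (metis imageE)
  then obtain S where S: "\<And>i. i \<in> Idx C \<Longrightarrow> S i \<in> vspace B"
    and GS: "\<And>i. i \<in> Idx C \<Longrightarrow> lin G (S i) = basis i" by metis
  have GF: "lin G (F i) = 0" if "i \<in> Idx A" for i
  proof -
    have "lin F (basis i) \<in> {v \<in> vspace B. lin G v = 0}" unfolding ker using that mem by blast
    then show ?thesis by simp
  qed
  have kS: "Poly_Mapping.keys (S i) \<subseteq> Idx B" if "i \<in> Idx C" for i
    using S[OF that] by (simp add: vspace_def)
  have "\<exists>u. u \<in> vspace A \<and> lin F u = basis i - lin S (G i)" if i: "i \<in> Idx B" for i
  proof -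
    have Gi: "G i \<in> vspace C" using is_hom_keys[OF hG i] by (simp add: vspace_def)
    have "lin S (G i) \<in> vspace B" by (rule lin_vspace[OF Gi kS])
    then have "basis i - lin S (G i) \<in> vspace B"
      using i Poly_Mapping.keys_diff[of "basis i" "lin S (G i)"] by (auto simp: vspace_def)
    moreover have "lin G (basis i - lin S (G i)) = 0"
      by (simp add: lin_diff lin_inverse[OF Gi GS])
    ultimately show ?thesis using ker by (metis (mono_tags, lifting) imageE mem_Collect_eq)
  qed
  then obtain R where R: "\<And>i. i \<in> Idx B \<Longrightarrow> R i \<in> vspace A"
    and FR: "\<And>i. i \<in> Idx B \<Longrightarrow> lin F (R i) = basis i - lin S (G i)" by metis
  have kR: "Poly_Mapping.keys (R i) \<subseteq> Idx A" if "i \<in> Idx B" for i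
    using R[OF that] by (simp add: vspace_def)
  have "lin R (F i) = basis i" if i: "i \<in> Idx A" for i
  proof -
    have Fi: "F i \<in> vspace B" using is_hom_keys[OF hF i] by (simp add: vspace_def)
    have "lin F (lin R (F i)) = lin (\<lambda>j. basis j - lin S (G j)) (F i)"
      unfolding lin_lin using Fi FR by (intro lin_cong) (auto simp: vspace_def)
    also have "\<dots> = F i - lin S (lin G (F i))"
      by (simp add: lin_lin flip: lin_minus)
    finally have "lin F (lin R (F i)) = lin F (basis i)" using GF[OF i] by simp
    moreover have "lin R (F i) \<in> vspace A" by (rule lin_vspace[OF Fi kR])
    ultimately show ?thesis using inj i mem by (metis inj_onD)
  qed
  then have "split_exact A B C F G R S"
    unfolding split_exact_def using hF hG kR kS GS GF FR by simp
  then show ?thesis by (rule that)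
qed

text \<open>Since \<open>F\<close> is even, it commutes with the parity operator on the first
  factor, so the sign in 1 \<otimes> E causes no trouble.\<close>

lemma is_hom_tensor_right:
  assumes "is_hom A B F"
  shows "is_hom (tensor A N) (tensor B N) (tmap F basis)"
proof (rule is_homI)
  fix k assume "k \<in> Idx (tensor A N)"
  then show "Poly_Mapping.keys (tmap F basis k) \<subseteq> Idx (tensor B N)"
    using is_hom_keys[OF assms] by (auto simp: keys_vtensor image_iff) blast
next
  fix k l assume "k \<in> Idx (tensor A N)" "l \<in> Poly_Mapping.keys (tmap F basis k)"
  then show "odd_idx (tensor B N) l = odd_idx (tensor A N) k"
    using assms by (auto simp: keys_vtensor is_hom_def)
next
  fix g k assume "k \<in> Idx (tensor A N)"
  then obtain i j where k: "k = prod_encode (i, j)" and i: "i \<in> Idx A" by auto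
  have "lin (parity B) (F i) = smul (if odd_idx A i then - 1 else 1) (F i)"
    using assms i by (intro lin_parity) (auto simp: is_hom_def)
  then have "lin F (parity A i) = lin (parity B) (F i)"
    by (simp add: parity_def lin_single)
  then show "lin (tmap F basis) (act (tensor A N) g k) = opr (tensor B N) g (tmap F basis k)"
    using is_hom_act[OF assms i]
    by (cases g) (simp_all add: k act_tensor_E act_tensor_K opr_tensor_E opr_tensor_K lin_add lin_tmap)
qed

lemma is_hom_tensor_left:
  assumes "is_hom A B F"
  shows "is_hom (tensor N A) (tensor N B) (tmap basis F)"
proof (rule is_homI)
  fix k assume "k \<in> Idx (tensor N A)"
  then show "Poly_Mapping.keys (tmap basis F k) \<subseteq> Idx (tensor N B)"
    using is_hom_keys[OF assms] by (auto simp: keys_vtensor image_iff) blast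
next
  fix k l assume "k \<in> Idx (tensor N A)" "l \<in> Poly_Mapping.keys (tmap basis F k)"
  then show "odd_idx (tensor N B) l = odd_idx (tensor N A) k"
    using assms by (auto simp: keys_vtensor is_hom_def)
next
  fix g k assume "k \<in> Idx (tensor N A)"
  then obtain i j where k: "k = prod_encode (i, j)" and j: "j \<in> Idx A" by auto
  show "lin (tmap basis F) (act (tensor N A) g k) = opr (tensor N B) g (tmap basis F k)"
    using is_hom_act[OF assms j]
    by (cases g) (simp_all add: k act_tensor_E act_tensor_K opr_tensor_E opr_tensor_K lin_add lin_tmap)
qed

text \<open>The splitting maps are merely linear, but the identities that express exactness survive
  tensoring with the identity.\<close>

lemma short_exact_tensor_right:
  assumes "short_exact A B C"
  shows "short_exact (tensor A N) (tensor B N) (tensor C N)"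
proof -
  from assms obtain F G R S where "split_exact A B C F G R S"
    by (rule short_exact_imp_split_exact)
  then have "split_exact (tensor A N) (tensor B N) (tensor C N)
      (tmap F basis) (tmap G basis) (tmap R basis) (tmap S basis)"
    by (auto simp: split_exact_def is_hom_tensor_right lin_tmap subset_eq keys_vtensor
        simp flip: vtensor_add)
  then show ?thesis by (rule split_exact_imp_short_exact)
qed

lemma short_exact_tensor_left:
  assumes "short_exact A B C"
  shows "short_exact (tensor N A) (tensor N B) (tensor N C)"
proof -
  from assms obtain F G R S where "split_exact A B C F G R S"
    by (rule short_exact_imp_split_exact)
  then have "split_exact (tensor N A) (tensor N B) (tensor N C)
      (tmap basis F) (tmap basis G) (tmap basis R) (tmap basis S)"
    by (auto simp: split_exact_def is_hom_tensor_left lin_tmap subset_eq keys_vtensor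
        simp flip: vtensor_add)
  then show ?thesis by (rule split_exact_imp_short_exact)
qed

section \<open>The quotient by exact sequences\<close>

text \<open>As an iterated \<open>frag_extend\<close>, the product inherits additivity in each
  argument.\<close>

lemma tensor_frag_extend:
  "tensor_frag x y = frag_extend (\<lambda>M. frag_extend (\<lambda>N. frag_of (tensor M N)) y) x"
proof -
  have eq: "Poly_Mapping.single k (c * d) = frag_cmul c (frag_cmul d (frag_of k))" for k :: srep and c d
    by (rule poly_mapping_eqI) (simp add: lookup_single when_def)
  show ?thesis
    unfolding tensor_frag_def frag_extend_def frag_cmul_sum by (intro sum.cong refl eq)
qed

lemma tensor_frag_diff:
  "tensor_frag (x - x') y = tensor_frag x y - tensor_frag x' y"
  "tensor_frag x (y - y') = tensor_frag x y - tensor_frag x y'"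
proof -
  show "tensor_frag (x - x') y = tensor_frag x y - tensor_frag x' y"
    by (simp add: tensor_frag_extend frag_extend_diff)
  have frag_cmul_diff: "frag_cmul c (a - b) = frag_cmul c a - frag_cmul c b" for c and a b :: "srep \<Rightarrow>\<^sub>0 int"
    by (rule poly_mapping_eqI) (simp add: lookup_minus algebra_simps)
  show "tensor_frag x (y - y') = tensor_frag x y - tensor_frag x y'"
    unfolding tensor_frag_extend frag_extend_diff
    by (simp add: frag_extend_def frag_cmul_diff flip: sum_subtractf)
qed

lemma tensor_frag_zero [simp]: "tensor_frag 0 y = 0" "tensor_frag x 0 = 0"
  by (simp_all add: tensor_frag_def)

lemma tensor_frag_of [simp]: "tensor_frag (frag_of M) (frag_of N) = frag_of (tensor M N)"
  by (simp add: tensor_frag_extend)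

lemma tensor_frag_minus: "tensor_frag (- x) y = - tensor_frag x y"
  using tensor_frag_diff(1)[of 0 x y] by simp

lemma exact_rel_minus: "x \<in> exact_rel q \<Longrightarrow> - x \<in> exact_rel q"
  using exact_rel.diff[OF exact_rel.zero] by fastforce

lemma exact_rel_add: "x \<in> exact_rel q \<Longrightarrow> y \<in> exact_rel q \<Longrightarrow> x + y \<in> exact_rel q"
  using exact_rel.diff[OF _ exact_rel_minus] by fastforce

lemma exact_rel_keys:
  assumes "x \<in> exact_rel q"
  shows "Poly_Mapping.keys x \<subseteq> catO q"
  using assms
proof induction
  case (ses A B C)
  have "Poly_Mapping.keys (frag_of B - frag_of A - frag_of C) \<subseteq> {A, B, C}"
    using keys_diff[of "frag_of B - frag_of A" "frag_of C"] keys_diff[of "frag_of B" "frag_of A"] by auto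
  then show ?case using ses by blast
next
  case (diff x y)
  then show ?case using keys_diff[of x y] by blast
qed simp

text \<open>The absorption law of a two-sided ideal. Additivity reduces it to a generator from one
  exact sequence and a single module, where exactness of the tensor product applies.\<close>

lemma exact_rel_tensor:
  assumes q: "q \<noteq> 0" "q + inverse q \<noteq> 0" and x: "x \<in> exact_rel q" and y: "Poly_Mapping.keys y \<subseteq> catO q"
  shows "tensor_frag x y \<in> exact_rel q" "tensor_frag y x \<in> exact_rel q"
proof -
  have ses_tensor: "tensor_frag (frag_of B - frag_of A - frag_of C) y \<in> exact_rel q
      \<and> tensor_frag y (frag_of B - frag_of A - frag_of C) \<in> exact_rel q"
    if ABC: "A \<in> catO q" "B \<in> catO q" "C \<in> catO q" "short_exact A B C" for A B C
    using y
  proof (induction y rule: frag_induction)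
    case zero
    then show ?case by (simp add: exact_rel.zero)
  next
    case (one N)
    then show ?case using ABC q
      by (auto simp: tensor_frag_diff intro!: exact_rel.ses tensor_catO
          short_exact_tensor_left short_exact_tensor_right)
  next
    case (diff a b)
    then show ?case
      by (metis exact_rel.diff tensor_frag_diff)
  qed
  have "tensor_frag x y \<in> exact_rel q \<and> tensor_frag y x \<in> exact_rel q"
    using x
  proof induction
    case zero
    then show ?case by (simp add: exact_rel.zero)
  next
    case (ses A B C)
    then show ?case by (rule ses_tensor)
  next
    case (diff a b)
    then show ?case by (simp add: tensor_frag_diff exact_rel.diff)
  qed
  then show "tensor_frag x y \<in> exact_rel q" "tensor_frag y x \<in> exact_rel q" by auto
qed

section \<open>Sums and products of cosets\<close>

lemma pre_groth_simps [simp]: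
  "carrier (pre_groth q) = {x. Poly_Mapping.keys x \<subseteq> catO q}"
  "x \<otimes>\<^bsub>pre_groth q\<^esub> y = tensor_frag x y"
  "x \<oplus>\<^bsub>pre_groth q\<^esub> y = x + y"
  "\<zero>\<^bsub>pre_groth q\<^esub> = 0"
  by (simp_all add: pre_groth_def)

lemma abelian_group_pre_groth: "abelian_group (pre_groth q)"
proof (rule abelian_groupI)
  fix x assume "x \<in> carrier (pre_groth q)"
  then show "\<exists>y\<in>carrier (pre_groth q). y \<oplus>\<^bsub>pre_groth q\<^esub> x = \<zero>\<^bsub>pre_groth q\<^esub>"
    by (intro bexI[of _ "- x"]) simp_all
next
  fix x y assume "x \<in> carrier (pre_groth q)" "y \<in> carrier (pre_groth q)"
  then show "x \<oplus>\<^bsub>pre_groth q\<^esub> y \<in> carrier (pre_groth q)"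
    using Poly_Mapping.keys_add[of x y] by auto
qed (simp_all add: ac_simps)

lemma a_inv_pre_groth:
  assumes "x \<in> carrier (pre_groth q)"
  shows "\<ominus>\<^bsub>pre_groth q\<^esub> x = - x"
  using assms by (intro abelian_group.minus_equality[OF abelian_group_pre_groth]) simp_all

lemma abelian_subgroup_exact_rel: "abelian_subgroup (exact_rel q) (pre_groth q)"
proof (rule abelian_subgroupI3)
  interpret abelian_group "pre_groth q" by (rule abelian_group_pre_groth)
  show "additive_subgroup (exact_rel q) (pre_groth q)"
  proof (rule additive_subgroupI, rule group.subgroupI)
    show "Group.group (add_monoid (pre_groth q))" by (rule a_group)
    show "exact_rel q \<subseteq> carrier (add_monoid (pre_groth q))" using exact_rel_keys by auto
    show "exact_rel q \<noteq> {}" using exact_rel.zero by blast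
    fix x assume x: "x \<in> exact_rel q"
    show "inv\<^bsub>add_monoid (pre_groth q)\<^esub> x \<in> exact_rel q"
      using a_inv_pre_groth[of x q] exact_rel_keys[OF x] exact_rel_minus[OF x]
      by (simp add: a_inv_def)
  next
    fix x y assume "x \<in> exact_rel q" "y \<in> exact_rel q"
    then show "x \<otimes>\<^bsub>add_monoid (pre_groth q)\<^esub> y \<in> exact_rel q"
      using exact_rel_add by simp
  qed
qed (rule abelian_group_pre_groth)

text \<open>Extends \<open>cls\<close> from single modules to formal combinations, so that sums and
  negatives of classes have representatives.\<close>

definition coset :: "complex \<Rightarrow> (srep \<Rightarrow>\<^sub>0 int) \<Rightarrow> (srep \<Rightarrow>\<^sub>0 int) set" where
  "coset q x = exact_rel q +>\<^bsub>pre_groth q\<^esub> x"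

lemma mem_coset: "z \<in> coset q x \<longleftrightarrow> z - x \<in> exact_rel q"
proof -
  have "z \<in> coset q x \<longleftrightarrow> (\<exists>h\<in>exact_rel q. z = h + x)"
    by (simp add: coset_def a_r_coset_def r_coset_def)
  then show ?thesis by (metis add_diff_cancel diff_add_cancel)
qed

lemma coset_eqI:
  assumes "x - y \<in> exact_rel q"
  shows "coset q x = coset q y"
proof -
  have "z - x \<in> exact_rel q \<longleftrightarrow> z - y \<in> exact_rel q" for z
    using exact_rel_add[OF _ assms, of "z - x"] exact_rel.diff[OF _ assms, of "z - y"] by auto
  then show ?thesis by (auto simp: mem_coset)
qed

lemma abelian_group_groth: "abelian_group (groth q)"
proof -
  interpret abelian_subgroup "exact_rel q" "pre_groth q" by (rule abelian_subgroup_exact_rel)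
  show ?thesis unfolding groth_def
    by (rule comm_group_abelian_groupI)
      (simp add: FactRing_def a_factorgroup_is_comm_group[unfolded A_FactGroup_def'])
qed

lemma groth_add:
  assumes "Poly_Mapping.keys x \<subseteq> catO q" "Poly_Mapping.keys y \<subseteq> catO q"
  shows "coset q x \<oplus>\<^bsub>groth q\<^esub> coset q y = coset q (x + y)"
proof -
  interpret abelian_subgroup "exact_rel q" "pre_groth q" by (rule abelian_subgroup_exact_rel)
  show ?thesis using a_rcos_sum[of x y] assms
    by (simp add: groth_def FactRing_def coset_def)
qed

lemma coset_carrier:
  assumes "Poly_Mapping.keys x \<subseteq> catO q"
  shows "coset q x \<in> carrier (groth q)"
proof -
  interpret abelian_subgroup "exact_rel q" "pre_groth q" by (rule abelian_subgroup_exact_rel)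
  show ?thesis using a_rcosetsI[OF a_subset, of x] assms
    by (simp add: groth_def FactRing_def coset_def)
qed

lemma groth_minus:
  assumes "Poly_Mapping.keys x \<subseteq> catO q"
  shows "\<ominus>\<^bsub>groth q\<^esub> coset q x = coset q (- x)"
proof (rule abelian_group.minus_equality[OF abelian_group_groth])
  have "coset q 0 = \<zero>\<^bsub>groth q\<^esub>"
    by (auto simp: mem_coset groth_def FactRing_def)
  then show "coset q (- x) \<oplus>\<^bsub>groth q\<^esub> coset q x = \<zero>\<^bsub>groth q\<^esub>"
    using assms by (simp add: groth_add)
qed (use assms in \<open>simp_all add: coset_carrier\<close>)

text \<open>The product in a factor ring is the union of the cosets of all products of
  representatives. These cosets coincide, because uv - xy = (u - x)v + x(v - y) and both terms are
  absorbed by \<open>exact_rel q\<close>.\<close>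

lemma groth_mult:
  assumes q: "q \<noteq> 0" "q + inverse q \<noteq> 0"
    and x: "Poly_Mapping.keys x \<subseteq> catO q" and y: "Poly_Mapping.keys y \<subseteq> catO q"
  shows "coset q x \<otimes>\<^bsub>groth q\<^esub> coset q y = coset q (tensor_frag x y)"
proof -
  have "coset q (tensor_frag u v) = coset q (tensor_frag x y)"
    if u: "u \<in> coset q x" and v: "v \<in> coset q y" for u v
  proof (rule coset_eqI)
    have "u - x \<in> exact_rel q" "v - y \<in> exact_rel q" using u v by (simp_all add: mem_coset)
    moreover from this have "Poly_Mapping.keys v \<subseteq> catO q"
      using exact_rel_keys Poly_Mapping.keys_add[of "v - y" y] y by fastforce
    ultimately have "tensor_frag (u - x) v + tensor_frag x (v - y) \<in> exact_rel q"
      using x by (intro exact_rel_add exact_rel_tensor[OF q])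
    then show "tensor_frag u v - tensor_frag x y \<in> exact_rel q"
      by (simp add: tensor_frag_diff)
  qed
  then have "(\<Union>u\<in>coset q x. \<Union>v\<in>coset q y. coset q (tensor_frag u v))
      = (\<Union>u\<in>coset q x. \<Union>v\<in>coset q y. coset q (tensor_frag x y))"
    by (intro SUP_cong refl)
  \<comment> \<open>A union of one constant set equals that set only over nonempty index sets;
    \<open>x\<close> and \<open>y\<close> lie in their own cosets.\<close>
  also have "\<dots> = coset q (tensor_frag x y)"
    using exact_rel.zero mem_coset[of x q x] mem_coset[of y q y] by auto
  finally show ?thesis
    by (simp add: groth_def FactRing_def rcoset_mult_def flip: coset_def)
qed

lemma cls_coset: "cls q M = coset q (frag_of M)"
  by (simp add: cls_def coset_def)

section \<open>The two short exact sequences\<close>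

lemma prod_encode_0_0: "prod_encode (0, 0) = 0"
  by (simp add: prod_encode_def)

lemma rho_simps [simp]: "Idx (rho q \<epsilon> \<mu>) = UNIV" "odd_idx (rho q \<epsilon> \<mu>) = odd"
  by (simp_all add: rho_def)

lemma W1_simps [simp]: "Idx (W1 s lam) = {0, 1}" "odd_idx (W1 s lam) i \<longleftrightarrow> i = 1"
  by (simp_all add: W1_def)

lemma W1_rho_act:
  fixes q s lam \<mu> :: complex and \<epsilon>
  defines "T \<equiv> tensor (W1 s lam) (rho q \<epsilon> \<mu>)" and "c \<equiv> osc_coeff q (opp \<epsilon>)"
  shows
    "act T (E N0) (prod_encode (0, k)) = Poly_Mapping.single (prod_encode (Suc 0, k)) (lam * (q * q) ^ k)
       + Poly_Mapping.single (prod_encode (0, Suc k)) \<mu>"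
    "act T (E N0) (prod_encode (Suc 0, k)) = Poly_Mapping.single (prod_encode (Suc 0, Suc k)) (- \<mu>)"
    "act T (E N1) (prod_encode (0, k)) = Poly_Mapping.single (prod_encode (0, k - 1)) (\<mu> * c k)"
    "act T (E N1) (prod_encode (Suc 0, k)) = Poly_Mapping.single (prod_encode (0, k)) (lam * inverse ((q * q) ^ k))
       + Poly_Mapping.single (prod_encode (Suc 0, k - 1)) (- \<mu> * c k)"
    "act T (K N0) (prod_encode (0, k)) = Poly_Mapping.single (prod_encode (0, k)) (inverse s * (q * q) ^ k)"
    "act T (K N0) (prod_encode (Suc 0, k)) = Poly_Mapping.single (prod_encode (Suc 0, k)) (- s * (q * q) ^ k)"
    "act T (K N1) (prod_encode (0, k)) = Poly_Mapping.single (prod_encode (0, k)) (s * inverse ((q * q) ^ k))"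
    "act T (K N1) (prod_encode (Suc 0, k)) = Poly_Mapping.single (prod_encode (Suc 0, k)) (- inverse s * inverse ((q * q) ^ k))"
  by (simp_all add: T_def c_def act_tensor_E act_tensor_K rho_act parity_def W1_def del: single_one)

text \<open>Treats U_1 and the tensor product standing for
  \<open>\<sigma>[U\<^sub>-\<^sub>1]\<close> uniformly, without replacing the latter by an
  isomorphic module; the index set stays \<open>{0}\<close> because
  \<open>prod_encode (0, 0) = 0\<close>.\<close>

definition is_character :: "srep \<Rightarrow> bool \<Rightarrow> complex \<Rightarrow> bool" where
  "is_character X e \<kappa> \<longleftrightarrow> Idx X = {0} \<and> odd_idx X 0 = e \<and> (\<forall>n. act X (E n) 0 = 0) \<and>
     act X (K N1) 0 = Poly_Mapping.single 0 \<kappa> \<and> act X (K N0) 0 = Poly_Mapping.single 0 (inverse \<kappa>)"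

lemma is_character_U: "is_character (U s \<epsilon> p) (\<epsilon> = Minus) (of_int (sg \<epsilon>) * s powi p)"
  by (cases \<epsilon>) (auto simp: is_character_def U_def power_int_minus)

lemma is_character_tensor:
  assumes "is_character X e \<kappa>" "is_character Y f \<mu>"
  shows "is_character (tensor X Y) (e \<noteq> f) (\<kappa> * \<mu>)"
  using assms odd_tensor[of X Y 0 0] unfolding is_character_def
  by (simp add: act_tensor_E act_tensor_K tmap_encode[of _ _ 0 0, unfolded prod_encode_0_0] prod_encode_0_0 parity_def
      del: odd_tensor)

lemma character_rho_act:
  fixes q \<kappa> \<mu> :: complex and X \<epsilon>
  defines "T \<equiv> tensor X (rho q \<epsilon> \<mu>)" and "c \<equiv> osc_coeff q (opp \<epsilon>)"
  assumes X: "is_character X e \<kappa>"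
  shows
    "act T (E N0) (prod_encode (0, k)) = Poly_Mapping.single (prod_encode (0, Suc k)) (if e then - \<mu> else \<mu>)"
    "act T (E N1) (prod_encode (0, k)) = Poly_Mapping.single (prod_encode (0, k - 1)) ((if e then - \<mu> else \<mu>) * c k)"
    "act T (K N0) (prod_encode (0, k)) = Poly_Mapping.single (prod_encode (0, k)) (inverse \<kappa> * (q * q) ^ k)"
    "act T (K N1) (prod_encode (0, k)) = Poly_Mapping.single (prod_encode (0, k)) (\<kappa> * inverse ((q * q) ^ k))"
  using X by (simp_all add: T_def c_def act_tensor_E act_tensor_K rho_act parity_def is_character_def del: single_one)

lemma character_Idx: "is_character X e \<kappa> \<Longrightarrow> Idx X = {0}"
  and character_odd: "is_character X e \<kappa> \<Longrightarrow> odd_idx X 0 = e"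
  by (simp_all add: is_character_def)

text \<open>A map out of the tensor product with \<open>W1\<close>, given on the rows \<open>v\<^sub>1\<^sub>/\<^sub>2 \<otimes> w\<^sub>n\<close> and
  \<open>v\<^sub>-\<^sub>1\<^sub>/\<^sub>2 \<otimes> w\<^sub>n\<close>.\<close>

definition two_row :: "(nat \<Rightarrow> vec) \<Rightarrow> (nat \<Rightarrow> vec) \<Rightarrow> nat \<Rightarrow> vec" where
  "two_row f g k = (case prod_decode k of (i, n) \<Rightarrow> if i = 0 then f n else g n)"

lemma two_row_simps [simp]:
  "two_row f g (prod_encode (0, n)) = f n" "two_row f g (prod_encode (Suc i, n)) = g n"
  by (simp_all add: two_row_def)

lemma osc_coeff_Minus_Suc:
  assumes "q \<noteq> 0" "q * q + 1 \<noteq> 0"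
  shows "osc_coeff q Minus (Suc k) = - 1 / (q * q + 1) - osc_coeff q Minus k / (q * q)"
  unfolding osc_coeff_Suc osc_const_def
  using assms by (simp add: power_int_minus power2_eq_square divide_simps)

lemma osc_coeff_Plus_Suc:
  assumes "q \<noteq> 0" "q * q + 1 \<noteq> 0"
  shows "osc_coeff q Plus (Suc k) = - (q * q) / (q * q + 1) - q * q * osc_coeff q Plus k"
  unfolding osc_coeff_Suc osc_const_def
  using assms by (simp add: power_int_minus power2_eq_square divide_simps)

text \<open>The submodule is spanned by \<open>v\<^sub>1\<^sub>/\<^sub>2 \<otimes> w\<^sub>k + y\<^sub>k v\<^sub>-\<^sub>1\<^sub>/\<^sub>2 \<otimes> w\<^sub>k\<^sub>-\<^sub>1\<close>, the orbit of
  \<open>v\<^sub>1\<^sub>/\<^sub>2 \<otimes> w\<^sub>0\<close> under \<open>E\<^sub>0\<close>; this forces \<open>y\<^sub>k\<^sub>+\<^sub>1 = q\<^sup>2\<^sup>k - y\<^sub>k\<close>, which a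
  multiple of \<open>q\<^sup>2\<^sup>k c\<^sub>k\<close> solves (\<open>c\<^sub>k\<close> the oscillator coefficients). The truncated index \<open>k - 1\<close> at \<open>k = 0\<close>
  is harmless because \<open>y\<^sub>0 = 0\<close>.\<close>

lemma short_exact_rho_Plus:
  fixes q s lam :: complex
  assumes q: "q \<noteq> 0" "q + inverse q \<noteq> 0" and s: "s = - \<i> * q"
    and X: "is_character X False s" and Y: "is_character Y True (- inverse s)"
  shows "short_exact (tensor X (rho q Plus (s * lam))) (tensor (W1 s lam) (rho q Plus lam))
    (tensor Y (rho q Plus (inverse s * lam)))"
proof -
  define Q where "Q = q * q"
  have Q: "s * s = - Q" "Q \<noteq> 0" "Q + 1 \<noteq> 0" and s0: "s \<noteq> 0"
    using q by (auto simp: s Q_def field_simps)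
  define c where "c = osc_coeff q Minus"
  have c: "c 0 = 0" "\<And>k. c (Suc k) = - 1 / (Q + 1) - c k / Q"
    using osc_coeff_Minus_Suc[OF q(1)] Q by (simp_all add: c_def Q_def del: osc_coeff.simps(2))
  \<comment> \<open>The factor in front normalises \<open>y 1\<close> to 1, as
    \<open>c 1 = - 1 / (Q + 1)\<close>.\<close>
  define y where "y k = - (Q + 1) * Q ^ k * c k / Q" for k
  have y: "y 0 = 0" by (simp add: y_def c)
  have ySuc: "y (Suc k) = Q ^ k - y k" for k
  proof -
    have "(Q + 1) * c (Suc k) = - 1 - (Q + 1) * c k / Q"
      using Q(3) by (simp add: c(2) right_diff_distrib)
    moreover have "y (Suc k) = - (Q ^ k * ((Q + 1) * c (Suc k)))"
      using Q(2) by (simp add: y_def) (simp add: algebra_simps)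
    ultimately have "y (Suc k) = - (Q ^ k * (- 1 - (Q + 1) * c k / Q))" by simp
    also have "\<dots> = Q ^ k - y k" by (simp add: y_def algebra_simps add_divide_distrib diff_divide_distrib)
    finally show ?thesis .
  qed
  \<comment> \<open>\<open>yc\<close> and \<open>ycc\<close> are the conditions for E_1 to preserve
    the submodule with the right factor: they compare the components along the even and the odd
    vector of \<open>W1\<close>.\<close>
  have yc: "y (Suc k) * inverse (Q ^ k) = - (Q + 1) * c (Suc k)" for k
    using Q by (simp add: y_def)
  have ycc: "y (Suc k) * c k = Q * y k * c (Suc k)" for k
    using Q by (simp add: y_def)
  define t where "t = inverse s"
  have st: "s * t = 1" "t * s = 1" "\<And>z. s * (t * z) = z" "\<And>z. t * (s * z) = z" using s0 by (simp_all add: t_def)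
  have sQ: "s = - (Q * t)" using Q(1) st(1) by (metis minus_mult_left mult.assoc mult.right_neutral)
  have ts: "inverse s = t" "inverse t = - (Q * t)" using sQ by (simp_all add: t_def)
  have Qt: "Q * (t * z) = - (s * z)" for z by (simp add: sQ)
  have Qtt: "Q * (t * t) = - 1" "Q * (t * (t * z)) = - z" "s * (inverse Q * z) = - (t * z)" for z
  proof -
    show *: "Q * (t * t) = - 1" using st(1) by (simp add: sQ ac_simps minus_equation_iff[of _ 1])
    show "Q * (t * (t * z)) = - z" using arg_cong[OF *, of "\<lambda>u. u * z"] by (simp add: algebra_simps)
    show "s * (inverse Q * z) = - (t * z)" using Q(2) by (simp add: sQ)
  qed
  have stk: "s ^ k * t ^ k = 1" "t ^ k * s ^ k = 1" "s ^ k * (t ^ k * z) = z" for k z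
    by (simp_all add: st flip: power_mult_distrib mult.assoc)
  let ?A = "tensor X (rho q Plus (s * lam))" and ?B = "tensor (W1 s lam) (rho q Plus lam)"
    and ?C = "tensor Y (rho q Plus (inverse s * lam))"
  let ?a = "\<lambda>k. prod_encode (0, k)" and ?b = "\<lambda>k. prod_encode (Suc 0, k)"
  \<comment> \<open>On \<open>?a k\<close> plus \<open>y k\<close> times \<open>?b (k - 1)\<close>,
    E_0 raises the index with factor \<open>lam\<close> and E_1 lowers it with factor
    \<open>- Q * lam * c k\<close>. Rescaling by \<open>t ^ k\<close> turns these into
    \<open>s * lam\<close> and \<open>s * lam * c k\<close>, since
    \<open>s * s = - Q\<close>.\<close>
  define F where "F = two_row (\<lambda>k. Poly_Mapping.single (?a k) (t ^ k)
    + Poly_Mapping.single (?b (k - 1)) (t ^ k * y k)) (\<lambda>_. 0)"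
  \<comment> \<open>Modulo the submodule, \<open>?a k\<close> equals \<open>- y k\<close> times
    \<open>?b (k - 1)\<close>. On the classes of \<open>?b k\<close> the factors of E_0 and E_1 are
    \<open>- lam\<close> and \<open>lam * c k / Q\<close>; after rescaling they are
    \<open>- t * lam\<close> and \<open>- t * lam * c k\<close>, the minus sign being that of the
    odd \<open>Y\<close>.\<close>
  define G where "G = two_row (\<lambda>k. Poly_Mapping.single (?a (k - 1)) (- y k * t ^ (k - 1)))
    (\<lambda>k. Poly_Mapping.single (?a k) (t ^ k))"
  define R where "R = two_row (\<lambda>k. Poly_Mapping.single (?a k) (s ^ k)) (\<lambda>_. 0)"
  define S where "S = two_row (\<lambda>k. Poly_Mapping.single (?b k) (s ^ k)) (\<lambda>_. 0)"
  have IA: "Idx ?A = range ?a" and IC: "Idx ?C = range ?a" and IB: "Idx ?B = range ?a \<union> range ?b"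
    using character_Idx[OF X] character_Idx[OF Y] by auto
  note act = W1_rho_act[of s lam q Plus lam, folded Q_def, simplified opp.simps, folded c_def]
    character_rho_act[OF X, of q Plus, folded Q_def, simplified opp.simps, folded c_def]
    character_rho_act[OF Y, of q Plus, folded Q_def, simplified opp.simps, folded c_def]
  \<comment> \<open>\<open>e1\<close> to \<open>e4\<close> restate \<open>yc\<close> and
    \<open>ycc\<close> in the normal form reached by the simplifier: \<open>e1\<close>,
    \<open>e2\<close> serve E_1 under \<open>F\<close>, and \<open>e3\<close>, \<open>e4\<close>
    serve E_1 under \<open>G\<close>.\<close>
  have e1: "lam * (t * (t ^ m * (y (Suc m) * inverse (Q ^ m))))
      = lam * (s * (t ^ m * c (Suc m))) - lam * (t * (t ^ m * c (Suc m)))" for m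
    unfolding yc by (simp add: sQ algebra_simps)
  have e2: "lam * (t * (c m * (t ^ m * y (Suc m)))) = - (lam * (s * (y m * (t ^ m * c (Suc m)))))" for m
  proof -
    have "lam * (t * (c m * (t ^ m * y (Suc m)))) = lam * t * t ^ m * (y (Suc m) * c m)"
      by (simp add: ac_simps)
    then show ?thesis unfolding ycc by (simp add: sQ ac_simps)
  qed
  have e3: "lam * (t * (c m * (t ^ m * y (Suc m)))) = - (lam * (y m * (c (Suc m) * t ^ (m - Suc 0))))" for m
    unfolding e2 by (cases m) (simp_all add: y sQ ac_simps Qtt)
  have e4: "lam * (inverse Q * (t ^ m * (y (Suc m) * inverse (Q ^ m))))
      = lam * (t * (t * (t ^ m * c (Suc m)))) - lam * (t ^ m * c (Suc m))" for m
  proof -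
    have "inverse Q = - (t * t)" using Qtt(1) by (intro inverse_unique) simp
    then show ?thesis unfolding yc by (simp add: algebra_simps Qtt)
  qed
  have hF: "is_hom ?A ?B F"
  proof (rule is_homI)
    fix k assume "k \<in> Idx ?A"
    then obtain n where k: "k = ?a n" unfolding IA by blast
    show "Poly_Mapping.keys (F k) \<subseteq> Idx ?B"
      unfolding IB k F_def two_row_simps by (rule order.trans[OF Poly_Mapping.keys_add]) auto
    show "odd_idx ?B j = odd_idx ?A k" if "j \<in> Poly_Mapping.keys (F k)" for j
      using subsetD[OF Poly_Mapping.keys_add that[unfolded k F_def two_row_simps]] y
      by (cases n) (auto simp: k character_odd[OF X] split: if_splits)
    show "lin F (act ?A g k) = opr ?B g (F k)" for g
    proof -
      consider "g = E N0" | "g = E N1" | "g = K N0" | "g = K N1" by (metis gen.exhaust node.exhaust)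
      then show ?thesis
      proof cases
        case 1 then show ?thesis
          by (cases n) (simp_all add: k F_def opr_def lin_add lin_single act smul_simps y ySuc c(1) algebra_simps st
            del: single_one flip: single_add)
      next
        case 2
        then show ?thesis
          by (cases n) (simp_all add: k F_def opr_def lin_add lin_single act smul_simps y c(1) algebra_simps e1 e2
            del: single_one flip: single_add)
      next
        case 3 then show ?thesis
          by (cases n) (simp_all add: k F_def opr_def lin_add lin_single act smul_simps y c(1) algebra_simps st ts Qtt
            del: single_one flip: single_add)
      next
        case 4 then show ?thesis
          by (cases n) (simp_all add: k F_def opr_def lin_add lin_single act smul_simps y c(1) algebra_simps st ts Qtt
            del: single_one flip: single_add)
      qed
    qed
  qed
  have hG: "is_hom ?B ?C G"
  proof (rule is_homI)
    fix k assume "k \<in> Idx ?B"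
    then consider n where "k = ?a n" | n where "k = ?b n" unfolding IB by blast
    note k = this
    show "Poly_Mapping.keys (G k) \<subseteq> Idx ?C"
      using k unfolding IC by cases (auto simp: G_def)
    show "odd_idx ?C j = odd_idx ?B k" if "j \<in> Poly_Mapping.keys (G k)" for j
      using k
    proof cases
      case 1
      then show ?thesis using that y by (cases n) (auto simp: G_def character_odd[OF Y] split: if_splits)
    qed (use that in \<open>auto simp: G_def character_odd[OF Y] split: if_splits\<close>)
    show "lin G (act ?B g k) = opr ?C g (G k)" for g
    proof -
      consider "g = E N0" | "g = E N1" | "g = K N0" | "g = K N1" by (metis gen.exhaust node.exhaust)
      note g = this
      from k show ?thesis
      proof cases
        fix n assume ka: "k = ?a n"
        from g show ?thesis
        proof cases
          case 1
          then show ?thesis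
            by (cases n) (simp_all add: ka G_def opr_def lin_add lin_single act smul_simps y ySuc c(1) algebra_simps st ts Qtt
              del: single_one flip: single_add)
        next
          case 2
          then show ?thesis
            by (cases n) (simp_all add: ka G_def opr_def lin_add lin_single act smul_simps y c(1) algebra_simps e3 st ts Qtt
              del: single_one flip: single_add)
        next
          case 3
          then show ?thesis
            by (cases n) (simp_all add: ka G_def opr_def lin_add lin_single act smul_simps y c(1) algebra_simps st ts Qtt
              del: single_one flip: single_add)
        next
          case 4
          then show ?thesis
            by (cases n) (simp_all add: ka G_def opr_def lin_add lin_single act smul_simps y c(1) algebra_simps st ts Qtt
              del: single_one flip: single_add)
        qed
      next
        fix n assume ka: "k = ?b n"
        from g show ?thesis
        proof cases
          case 1
          then show ?thesis
            by (simp_all add: ka G_def opr_def lin_add lin_single act smul_simps y ySuc c(1) algebra_simps st ts Qtt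
              del: single_one flip: single_add)
        next
          case 2
          then show ?thesis
            by (cases n) (simp_all add: ka G_def opr_def lin_add lin_single act smul_simps y c(1) algebra_simps e4 st ts Qtt
              del: single_one flip: single_add)
        next
          case 3
          then show ?thesis
            by (simp_all add: ka G_def opr_def lin_add lin_single act smul_simps y c(1) algebra_simps Qt st ts Qtt
              del: single_one flip: single_add)
        next
          case 4
          then show ?thesis
            by (simp_all add: ka G_def opr_def lin_add lin_single act smul_simps y c(1) algebra_simps Qt st ts Qtt
              del: single_one flip: single_add)
        qed
      qed
    qed
  qed
  moreover have "\<forall>i\<in>Idx ?B. Poly_Mapping.keys (R i) \<subseteq> Idx ?A" "\<forall>i\<in>Idx ?C. Poly_Mapping.keys (S i) \<subseteq> Idx ?B"
    unfolding IA IB IC by (auto simp: R_def S_def s0)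
  moreover have "\<forall>i\<in>Idx ?A. lin R (F i) = basis i"
    unfolding IA by (auto simp: F_def R_def lin_add lin_single stk)
  moreover have "\<forall>i\<in>Idx ?C. lin G (S i) = basis i"
    unfolding IC by (auto simp: G_def S_def lin_add lin_single stk)
  moreover have "\<forall>i\<in>Idx ?A. lin G (F i) = 0"
    unfolding IA by (auto simp: F_def G_def lin_add lin_single stk simp flip: single_add)
  moreover have "\<forall>i\<in>Idx ?B. lin F (R i) + lin S (G i) = basis i"
  proof
    fix k assume "k \<in> Idx ?B"
    then consider n where "k = ?a n" | n where "k = ?b n" unfolding IB by blast
    then show "lin F (R k) + lin S (G k) = basis k"
    proof cases
      case (1 n)
      then show ?thesis
        by (cases n) (simp_all add: F_def G_def S_def R_def lin_single smul_simps y algebra_simps st stk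
          del: single_one flip: single_add)
    qed (simp add: F_def G_def S_def R_def lin_single stk)
  qed
  ultimately have "split_exact ?A ?B ?C F G R S"
    unfolding split_exact_def using hF hG by blast
  then show ?thesis by (rule split_exact_imp_short_exact)
qed

text \<open>Here submodule and quotient change places: the vector
  \<open>v\<^sub>1\<^sub>/\<^sub>2 \<otimes> w\<^sub>1 + z\<^sub>0 v\<^sub>-\<^sub>1\<^sub>/\<^sub>2 \<otimes> w\<^sub>0\<close> is annihilated by \<open>E\<^sub>1\<close> and generates the odd submodule.\<close>

lemma short_exact_rho_Minus:
  fixes q s lam :: complex
  assumes q: "q \<noteq> 0" "q + inverse q \<noteq> 0" and s: "s = - \<i> * q"
    and X: "is_character X False s" and Y: "is_character Y True (- inverse s)"
  shows "short_exact (tensor Y (rho q Minus (s * lam))) (tensor (W1 s lam) (rho q Minus lam))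
    (tensor X (rho q Minus (inverse s * lam)))"
proof -
  define Q where "Q = q * q"
  have Q: "s * s = - Q" "Q \<noteq> 0" "Q + 1 \<noteq> 0" and s0: "s \<noteq> 0"
    using q by (auto simp: s Q_def field_simps)
  define c where "c = osc_coeff q Plus"
  define Z where "Z = Q / (Q + 1)"
  have c: "c 0 = 0" "\<And>k. c (Suc k) = - Z - Q * c k"
    using osc_coeff_Plus_Suc[OF q(1)] Q by (simp_all add: c_def Q_def Z_def del: osc_coeff.simps(2))
  \<comment> \<open>For the vectors \<open>?a (Suc k)\<close> plus \<open>z k\<close> times
    \<open>?b k\<close>, annihilation of the first by E_1 forces \<open>z 0 = - c 1 = Z\<close>, and
    E_0 forces \<open>z (Suc k) = Q ^ Suc k - z k\<close>. This initial value selects the geometric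
    solution, which never vanishes; \<open>w\<close> is its reciprocal.\<close>
  define z where "z k = Q ^ Suc k / (Q + 1)" for k
  define w where "w k = (Q + 1) / Q ^ Suc k" for k
  define t where "t = inverse s"
  \<comment> \<open>On the submodule E_0 and E_1 have the factors \<open>lam\<close> and
    \<open>- Q * lam * c k\<close>. Rescaling by \<open>u ^ k\<close> makes them
    \<open>- s * lam\<close> and \<open>- s * lam * c k\<close>; the sign in \<open>u\<close>
    accounts for the odd \<open>Y\<close>.\<close>
  define u where "u = - t"
  define r where "r = - s"
  have st: "s * t = 1" "s * (t * x) = x" for x using s0 by (simp_all add: t_def)
  have pow: "s ^ k * t ^ k = 1" "u ^ k * r ^ k = 1" for k
    using s0 by (simp_all add: t_def u_def r_def flip: power_mult_distrib)
  have QS: "Q = - (s * s)" using Q(1) by simp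
  have iQ: "inverse Q = - (t * t)" using s0 by (simp add: QS t_def)
  have ts: "inverse s = t" by (simp add: t_def)
  note rel = QS u_def st iQ ts
  have z: "z (Suc k) = Q * Q ^ k - z k" for k
    using Q by (simp add: z_def divide_simps) (simp add: algebra_simps)
  have zQ: "z (Suc k) = Q * z k" for k
    by (simp add: z_def)
  have z0: "z 0 = Z" by (simp add: z_def Z_def)
  have ziQ: "z k * inverse (Q ^ k) = Z" "z k * (x * inverse (Q ^ k)) = x * Z" for k x
    using Q by (simp_all add: z_def Z_def)
  have zw: "z k * w k = 1" for k
    using Q by (simp add: z_def w_def)
  have w: "w (Suc k) = inverse Q * w k" for k
    using Q by (simp add: w_def divide_simps)
  have wZ: "inverse (Q ^ k) = Z * w k" for k
    using Q by (simp add: w_def Z_def divide_simps)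
  have w0: "Z * w 0 = 1" "Z * (x * w 0) = x" for x
    using wZ[of 0] by (simp_all add: mult.left_commute[of Z])
  have wQ: "w k * (Q ^ k * x) = x - t * (t * x)" for k x
  proof -
    have "Q ^ k * w k = 1 + inverse Q" using Q by (simp add: w_def field_simps)
    then have "w k * (Q ^ k * x) = (1 + inverse Q) * x" by (simp add: ac_simps flip: mult.assoc)
    then show ?thesis by (simp add: iQ algebra_simps)
  qed
  let ?A = "tensor Y (rho q Minus (s * lam))" and ?B = "tensor (W1 s lam) (rho q Minus lam)"
    and ?C = "tensor X (rho q Minus (inverse s * lam))"
  let ?a = "\<lambda>k. prod_encode (0, k)" and ?b = "\<lambda>k. prod_encode (Suc 0, k)"
  define F where "F = two_row (\<lambda>k. Poly_Mapping.single (?a (Suc k)) (u ^ k)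
    + Poly_Mapping.single (?b k) (u ^ k * z k)) (\<lambda>_. 0)"
  \<comment> \<open>Modulo the submodule, \<open>?b k\<close> equals \<open>- w k\<close> times
    \<open>?a (Suc k)\<close>. Hence E_0 raises the classes of \<open>?a k\<close> with factor
    \<open>lam * (1 - Q ^ k * w k) = - lam / Q\<close>, and E_1 lowers them with factor
    \<open>lam * c k\<close>; rescaling by \<open>s ^ k\<close> gives \<open>t * lam\<close> and
    \<open>t * lam * c k\<close>.\<close>
  define G where "G = two_row (\<lambda>k. Poly_Mapping.single (?a k) (s ^ k))
    (\<lambda>k. Poly_Mapping.single (?a (Suc k)) (- w k * s ^ Suc k))"
  define R where "R = two_row (\<lambda>_. 0) (\<lambda>k. Poly_Mapping.single (?a k) (w k * r ^ k))"
  define S where "S = two_row (\<lambda>k. Poly_Mapping.single (?a k) (t ^ k)) (\<lambda>_. 0)"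
  have IA: "Idx ?A = range ?a" and IC: "Idx ?C = range ?a" and IB: "Idx ?B = range ?a \<union> range ?b"
    using character_Idx[OF X] character_Idx[OF Y] by auto
  note act = W1_rho_act[of s lam q Minus lam, folded Q_def, simplified opp.simps, folded c_def]
    character_rho_act[OF X, of q Minus, folded Q_def, simplified opp.simps, folded c_def]
    character_rho_act[OF Y, of q Minus, folded Q_def, simplified opp.simps, folded c_def]
  have hF: "is_hom ?A ?B F"
  proof (rule is_homI)
    fix k assume "k \<in> Idx ?A"
    then obtain n where k: "k = ?a n" unfolding IA by blast
    show "Poly_Mapping.keys (F k) \<subseteq> Idx ?B"
      unfolding IB k F_def two_row_simps by (rule order.trans[OF Poly_Mapping.keys_add]) auto
    show "odd_idx ?B j = odd_idx ?A k" if "j \<in> Poly_Mapping.keys (F k)" for j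
      using subsetD[OF Poly_Mapping.keys_add that[unfolded k F_def two_row_simps]]
      by (auto simp: k character_odd[OF Y] split: if_splits)
    show "lin F (act ?A g k) = opr ?B g (F k)" for g
    proof -
      consider "g = E N0" | "g = E N1" | "g = K N0" | "g = K N1" by (metis gen.exhaust node.exhaust)
      then show ?thesis
      proof cases
          case 1
          then show ?thesis
            by (simp_all add: k F_def opr_def lin_add lin_single act smul_simps,
              (simp_all add: z algebra_simps)?,
              simp_all add:  algebra_simps rel del: single_one flip: single_add)
        next
          case 2
          then show ?thesis
            by (cases n) (simp_all add: k F_def opr_def lin_add lin_single act smul_simps,
              (simp_all add: c zQ z0 ziQ algebra_simps)?,
              simp_all add:  algebra_simps rel del: single_one flip: single_add)
        next
          case 3
          then show ?thesis
            by (simp_all add: k F_def opr_def lin_add lin_single act smul_simps,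
              simp_all add:  algebra_simps rel del: single_one flip: single_add)
        next
          case 4
          then show ?thesis
            by (simp_all add: k F_def opr_def lin_add lin_single act smul_simps,
              simp_all add:  algebra_simps rel del: single_one flip: single_add)
      qed
    qed
  qed
  have hG: "is_hom ?B ?C G"
  proof (rule is_homI)
    fix k assume "k \<in> Idx ?B"
    then consider n where "k = ?a n" | n where "k = ?b n" unfolding IB by blast
    note k = this
    show "Poly_Mapping.keys (G k) \<subseteq> Idx ?C"
      using k unfolding IC by cases (auto simp: G_def)
    show "odd_idx ?C j = odd_idx ?B k" if "j \<in> Poly_Mapping.keys (G k)" for j
      using k that by cases (auto simp: G_def character_odd[OF X] split: if_splits)
    show "lin G (act ?B g k) = opr ?C g (G k)" for g
    proof -
      consider "g = E N0" | "g = E N1" | "g = K N0" | "g = K N1" by (metis gen.exhaust node.exhaust)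
      note g = this
      from k show ?thesis
      proof cases
        fix n assume ka: "k = ?a n"
        from g show ?thesis
        proof cases
          case 1
          then show ?thesis
            by (simp_all add: ka G_def opr_def lin_add lin_single act smul_simps,
              (simp_all add: wQ algebra_simps)?,
              simp_all add:  algebra_simps rel del: single_one flip: single_add)
        next
          case 2
          then show ?thesis
            by (cases n) (simp_all add: ka G_def opr_def lin_add lin_single act smul_simps,
              simp_all add: c(1) algebra_simps rel del: single_one flip: single_add)
        next
          case 3
          then show ?thesis
            by (simp_all add: ka G_def opr_def lin_add lin_single act smul_simps,
              simp_all add:  algebra_simps rel del: single_one flip: single_add)
        next
          case 4
          then show ?thesis
            by (simp_all add: ka G_def opr_def lin_add lin_single act smul_simps,
              simp_all add:  algebra_simps rel del: single_one flip: single_add)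
        qed
      next
        fix n assume ka: "k = ?b n"
        from g show ?thesis
        proof cases
          case 1
          then show ?thesis
            by (simp_all add: ka G_def opr_def lin_add lin_single act smul_simps,
              (simp_all add: w algebra_simps)?,
              simp_all add:  algebra_simps rel del: single_one flip: single_add)
        next
          case 2
          then show ?thesis
            by (cases n) (simp_all add: ka G_def opr_def lin_add lin_single act smul_simps,
              (simp_all add: w wZ c algebra_simps)?,
              simp_all add: w0 algebra_simps rel del: single_one flip: single_add)
        next
          case 3
          then show ?thesis
            by (simp_all add: ka G_def opr_def lin_add lin_single act smul_simps,
              simp_all add:  algebra_simps rel del: single_one flip: single_add)
        next
          case 4
          then show ?thesis
            by (simp_all add: ka G_def opr_def lin_add lin_single act smul_simps,
              simp_all add:  algebra_simps rel del: single_one flip: single_add)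
        qed
      qed
    qed
  qed
  have "\<forall>i\<in>Idx ?B. Poly_Mapping.keys (R i) \<subseteq> Idx ?A" "\<forall>i\<in>Idx ?C. Poly_Mapping.keys (S i) \<subseteq> Idx ?B"
    unfolding IA IB IC by (auto simp: R_def S_def split: if_splits)
  moreover have "\<forall>i\<in>Idx ?A. lin R (F i) = basis i"
  proof -
    have "u ^ k * z k * (w k * r ^ k) = (u ^ k * r ^ k) * (z k * w k)" for k by (simp add: ac_simps)
    then show ?thesis unfolding IA by (auto simp: F_def R_def lin_add lin_single pow zw)
  qed
  moreover have "\<forall>i\<in>Idx ?C. lin G (S i) = basis i"
    unfolding IC by (auto simp: G_def S_def lin_single pow mult.commute)
  moreover have "\<forall>i\<in>Idx ?A. lin G (F i) = 0"
  proof -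
    have "u ^ k * z k * (w k * x) = (z k * w k) * (u ^ k * x)" for k x by (simp only: ac_simps)
    then have e: "u ^ k * z k * (w k * x) = u ^ k * x" for k x by (simp only: zw mult_1)
    show ?thesis unfolding IA by (auto simp: F_def G_def lin_add lin_single e simp flip: single_add)
  qed
  moreover have "\<forall>i\<in>Idx ?B. lin F (R i) + lin S (G i) = basis i"
  proof
    fix k assume "k \<in> Idx ?B"
    then consider n where "k = ?a n" | n where "k = ?b n" unfolding IB by blast
    then show "lin F (R k) + lin S (G k) = basis k"
    proof cases
      case (2 n)
      have "w n * r ^ n * (u ^ n * z n) = (u ^ n * r ^ n) * (z n * w n)"
        "w n * r ^ n * u ^ n = (u ^ n * r ^ n) * w n"
        "w n * s ^ Suc n * t ^ Suc n = w n * (s ^ Suc n * t ^ Suc n)" by (simp_all only: ac_simps)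
      then have e: "w n * r ^ n * (u ^ n * z n) = 1" "w n * r ^ n * u ^ n = w n"
        "w n * s ^ Suc n * t ^ Suc n = w n" by (simp_all only: pow zw mult_1 mult_1_right)
      show ?thesis using 2
        by (simp add: F_def G_def S_def R_def lin_single smul_simps e
          del: single_one power_Suc flip: single_add)
    qed (simp add: F_def G_def S_def R_def lin_single pow)
  qed
  ultimately have "split_exact ?A ?B ?C F G R S"
    unfolding split_exact_def using hF hG by blast
  then show ?thesis by (rule split_exact_imp_short_exact)
qed

section \<open>Odd highest weight vectors\<close>

text \<open>Basis vectors indexed by an invariant set span a submodule, so a generating vector
  cannot be supported on a proper invariant subset. This excludes odd highest weight vectors
  below.\<close>

lemma generates_invariant_subset:
  assumes gen: "generates M v" and v: "Poly_Mapping.keys v \<subseteq> J" and J: "J \<subseteq> Idx M"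
    and inv: "\<And>g i. i \<in> J \<Longrightarrow> Poly_Mapping.keys (act M g i) \<subseteq> J"
  shows "J = Idx M"
proof -
  let ?S = "{v :: vec. Poly_Mapping.keys v \<subseteq> J}"
  have "?S = vspace M"
  proof (rule gen[unfolded generates_def, rule_format, OF _ conjI])
    show "?S \<subseteq> vspace M" using J by (auto simp: vspace_def)
    show "v \<in> ?S" using v by simp
    show "(\<forall>x\<in>?S. \<forall>y\<in>?S. x + y \<in> ?S) \<and> (\<forall>c. \<forall>x\<in>?S. smul c x \<in> ?S) \<and>
        (\<forall>g. \<forall>x\<in>?S. opr M g x \<in> ?S)"
    proof (intro conjI allI ballI)
      fix x y assume "x \<in> ?S" "y \<in> ?S"
      then show "x + y \<in> ?S" using Poly_Mapping.keys_add[of x y] by auto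
    next
      fix c x assume "x \<in> ?S"
      then show "smul c x \<in> ?S" by (auto simp: in_keys_iff)
    next
      fix g x assume "x \<in> ?S"
      then show "opr M g x \<in> ?S" using inv by (simp add: opr_def keys_lin)
    qed
  qed
  then have "basis i \<in> ?S \<longleftrightarrow> basis i \<in> vspace M" for i by blast
  then show ?thesis by (auto simp: vspace_def)
qed

lemma odd_highest_U: "odd_highest (U s \<epsilon> p) \<longleftrightarrow> \<epsilon> = Minus"
proof
  assume "odd_highest (U s \<epsilon> p)"
  then obtain v :: vec where "v \<noteq> 0" "\<forall>i\<in>Poly_Mapping.keys v. odd_idx (U s \<epsilon> p) i"
    unfolding odd_highest_def highest_weight_vector_def by auto
  then obtain i where "odd_idx (U s \<epsilon> p) i"
    by (metis all_not_in_conv keys_eq_empty)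
  then show "\<epsilon> = Minus" by (simp add: U_def)
next
  assume \<epsilon>: "\<epsilon> = Minus"
  have span: "w = smul (Poly_Mapping.lookup w 0) (basis 0)" if "w \<in> vspace (U s \<epsilon> p)" for w
  proof (rule poly_mapping_eqI)
    fix k
    show "Poly_Mapping.lookup w k = Poly_Mapping.lookup (smul (Poly_Mapping.lookup w 0) (basis 0)) k"
      using that by (cases k) (auto simp: vspace_def U_def lookup_single not_in_keys_iff_lookup_eq_zero
          simp del: single_one)
  qed
  have "generates (U s \<epsilon> p) (basis 0)"
    unfolding generates_def by (metis (no_types, lifting) span subsetI subset_antisym)
  moreover have "opr (U s \<epsilon> p) (K n) (basis 0) = smul (Poly_Mapping.lookup (act (U s \<epsilon> p) (K n) 0) 0) (basis 0)" for n
    by (cases n) (simp_all add: opr_def U_def del: single_one)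
  moreover have "basis 0 \<in> vspace (U s \<epsilon> p)" "opr (U s \<epsilon> p) (E N1) (basis 0) = 0" "basis 0 \<noteq> 0"
    by (simp_all add: opr_def U_def vspace_def del: single_one) simp
  ultimately have "highest_weight_vector (U s \<epsilon> p) (basis 0)"
    unfolding highest_weight_vector_def by blast
  then show "odd_highest (U s \<epsilon> p)"
    unfolding odd_highest_def by (intro exI[of _ "basis 0"]) (simp add: U_def \<epsilon>)
qed

text \<open>An odd vector is a multiple of the second basis vector, which E_1 sends to
  \<open>lam\<close> times the first. If E_1 kills it, then \<open>lam = 0\<close>, and it spans a
  proper submodule.\<close>

lemma not_odd_highest_W1: "\<not> odd_highest (W1 s lam)"
proof
  assume "odd_highest (W1 s lam)"
  then obtain v where v: "v \<noteq> 0" "opr (W1 s lam) (E N1) v = 0" "generates (W1 s lam) v"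
    "\<forall>i\<in>Poly_Mapping.keys v. odd_idx (W1 s lam) i"
    unfolding odd_highest_def highest_weight_vector_def by auto
  then have keys: "Poly_Mapping.keys v \<subseteq> {1}" by auto
  moreover have "Poly_Mapping.keys v \<noteq> {}" using v(1) by simp
  ultimately have k1: "Poly_Mapping.keys v = {1}" by blast
  have "smul (Poly_Mapping.lookup v 1) (Poly_Mapping.single 0 lam) = 0"
    using v(2) by (simp add: opr_def lin_def k1 W1_def)
  moreover have "Poly_Mapping.lookup v 1 \<noteq> 0" using k1 by (simp flip: in_keys_iff)
  ultimately have "lam = 0" by (metis (no_types) lookup_single_eq lookup_smul lookup_zero mult_eq_0_iff)
  then have "{1} = Idx (W1 s lam)"
    by (intro generates_invariant_subset[OF v(3) keys])
      (auto simp: W1_def split: gen.splits node.splits if_splits)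
  then show False by auto
qed

text \<open>If \<open>E\<^sub>1\<close> annihilates an odd vector with lowest index \<open>m\<close>, then it annihilates \<open>w\<^sub>m\<close>, so the
  span of the \<open>w\<^sub>k\<close> with \<open>k \<ge> m > 0\<close> is a proper submodule, also when \<open>q\<close> is a root of unity.\<close>

lemma not_odd_highest_rho: "\<not> odd_highest (rho q \<epsilon> lam)"
proof
  assume "odd_highest (rho q \<epsilon> lam)"
  then obtain v where v: "v \<noteq> 0" "opr (rho q \<epsilon> lam) (E N1) v = 0" "generates (rho q \<epsilon> lam) v"
    and odd: "\<And>i. i \<in> Poly_Mapping.keys v \<Longrightarrow> odd i"
    unfolding odd_highest_def highest_weight_vector_def by auto
  define m where "m = Min (Poly_Mapping.keys v)"
  define e where "e k = lam * osc_coeff q (opp \<epsilon>) k" for k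
  have m: "m \<in> Poly_Mapping.keys v" using v(1) by (auto simp: m_def)
  have "Poly_Mapping.lookup (smul (Poly_Mapping.lookup v k) (act (rho q \<epsilon> lam) (E N1) k)) (m - 1)
      = (if k = m then Poly_Mapping.lookup v m * e m else 0)" if "k \<in> Poly_Mapping.keys v" for k
  proof -
    \<comment> \<open>Truncated subtraction is injective on odd indices, so the coordinate at
      \<open>m - 1\<close> comes from index \<open>m\<close> alone.\<close>
    have "k - 1 = m - 1 \<longleftrightarrow> k = m"
      using odd[OF that] odd[OF m] by (cases k; cases m) auto
    then show ?thesis unfolding rho_act lookup_smul lookup_single when_def e_def by auto
  qed
  then have "Poly_Mapping.lookup (opr (rho q \<epsilon> lam) (E N1) v) (m - 1)
      = (\<Sum>k\<in>Poly_Mapping.keys v. if k = m then Poly_Mapping.lookup v m * e m else 0)"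
    unfolding opr_def lin_def lookup_sum by (intro sum.cong refl)
  then have em: "e m = 0" using v(2) m by (simp add: in_keys_iff)
  have "{m..} = Idx (rho q \<epsilon> lam)"
  proof (rule generates_invariant_subset[OF v(3)])
    show "Poly_Mapping.keys v \<subseteq> {m..}" by (auto simp: m_def)
    fix g k assume k: "k \<in> {m..}"
    consider "g = E N0" | "g = E N1" | n where "g = K n" by (metis gen.exhaust node.exhaust)
    then show "Poly_Mapping.keys (act (rho q \<epsilon> lam) g k) \<subseteq> {m..}"
    proof cases
      case 2
      then show ?thesis using k em by (cases "k = m") (auto simp: rho_act e_def)
    next
      case (3 n)
      then show ?thesis using k by (cases n) (auto simp: rho_act)
    qed (use k in \<open>auto simp: rho_act\<close>)
  qed simp
  then have "m = 0" by auto
  then show False using odd[OF m] by simp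
qed

section \<open>Signs of the brackets and the Baxter relations\<close>

lemma bracket_simps:
  "bracket q (W1 s lam) = coset q (frag_of (W1 s lam))"
  "bracket q (rho q \<epsilon> lam) = coset q (frag_of (rho q \<epsilon> lam))"
  "bracket q (U s Plus p) = coset q (frag_of (U s Plus p))"
  "bracket q (U s Minus p) = \<ominus>\<^bsub>groth q\<^esub> coset q (frag_of (U s Minus p))"
  by (simp_all add: bracket_def cls_coset not_odd_highest_W1 not_odd_highest_rho odd_highest_U)

lemma groth_short_exact:
  assumes "A \<in> catO q" "B \<in> catO q" "C \<in> catO q" "short_exact A B C"
  shows "coset q (frag_of B) = coset q (frag_of A + frag_of C)"
  using exact_rel.ses[OF assms] by (intro coset_eqI) (simp add: diff_diff_eq)

text \<open>The minus sign of the relation cancels against the sign of the odd character's bracket,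
  leaving the sum of classes that a short exact sequence provides.\<close>

lemma baxter_rhs:
  assumes q: "q \<noteq> 0" "q + inverse q \<noteq> 0"
    and cat: "X \<in> catO q" "Y0 \<in> catO q" "Y1 \<in> catO q" "M \<in> catO q" "N \<in> catO q"
  shows "(coset q (frag_of X) \<otimes>\<^bsub>groth q\<^esub> coset q (frag_of M)) \<ominus>\<^bsub>groth q\<^esub>
      (((\<ominus>\<^bsub>groth q\<^esub> coset q (frag_of Y0)) \<otimes>\<^bsub>groth q\<^esub> coset q (frag_of Y1)) \<otimes>\<^bsub>groth q\<^esub> coset q (frag_of N))
    = coset q (frag_of (tensor X M) + frag_of (tensor (tensor Y0 Y1) N))"
  using cat tensor_catO[OF q]
  by (simp add: groth_mult[OF q] groth_minus groth_add a_minus_def tensor_frag_minus)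

theorem mainTheorem6:
  fixes b bs q qs lam :: complex
  assumes "b\<^sup>2 = bs\<^sup>2 + 1 / 2"
    and "q = exp (complex_of_real pi * \<i> * b\<^sup>2)"
    and "qs = - \<i> * q"
    and "q + inverse q \<noteq> 0"
  shows
    "bracket q (W1 qs lam) \<otimes>\<^bsub>groth q\<^esub> bracket q (rho q Plus lam) =
       (bracket q (U qs Plus 1) \<otimes>\<^bsub>groth q\<^esub> bracket q (rho q Plus (qs * lam)))
       \<ominus>\<^bsub>groth q\<^esub>
       ((bracket q (U qs Minus 0) \<otimes>\<^bsub>groth q\<^esub> bracket q (U qs Plus (- 1)))
          \<otimes>\<^bsub>groth q\<^esub> bracket q (rho q Plus (inverse qs * lam)))
     \<and>
     bracket q (W1 qs lam) \<otimes>\<^bsub>groth q\<^esub> bracket q (rho q Minus lam) =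
       (bracket q (U qs Plus 1) \<otimes>\<^bsub>groth q\<^esub> bracket q (rho q Minus (inverse qs * lam)))
       \<ominus>\<^bsub>groth q\<^esub>
       ((bracket q (U qs Minus 0) \<otimes>\<^bsub>groth q\<^esub> bracket q (U qs Plus (- 1)))
          \<otimes>\<^bsub>groth q\<^esub> bracket q (rho q Minus (qs * lam)))"
proof -
  have q: "q \<noteq> 0" "q + inverse q \<noteq> 0" and s0: "qs \<noteq> 0" using assms by simp_all
  let ?Y = "tensor (U qs Minus 0) (U qs Plus (- 1))"
  note catO = W1_catO[OF q(1) assms(3)] rho_catO[OF q] U_catO[OF s0] tensor_catO[OF q]
  have X: "is_character (U qs Plus 1) False qs"
    using is_character_U[of qs Plus 1] by simp
  have Y: "is_character ?Y True (- inverse qs)"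
    using is_character_tensor[OF is_character_U[of qs Minus 0] is_character_U[of qs Plus "- 1"]]
    by (simp add: power_int_minus)
  have "coset q (frag_of (tensor (W1 qs lam) (rho q Plus lam)))
      = coset q (frag_of (tensor (U qs Plus 1) (rho q Plus (qs * lam)))
          + frag_of (tensor ?Y (rho q Plus (inverse qs * lam))))"
    by (intro groth_short_exact catO short_exact_rho_Plus[OF q assms(3) X Y])
  \<comment> \<open>Here the odd twist is the submodule, so the two summands appear in the opposite
    order.\<close>
  moreover have "coset q (frag_of (tensor (W1 qs lam) (rho q Minus lam)))
      = coset q (frag_of (tensor ?Y (rho q Minus (qs * lam)))
          + frag_of (tensor (U qs Plus 1) (rho q Minus (inverse qs * lam))))"
    by (intro groth_short_exact catO short_exact_rho_Minus[OF q assms(3) X Y])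
  ultimately show ?thesis
    unfolding bracket_simps
      baxter_rhs[OF q U_catO[OF s0] U_catO[OF s0] U_catO[OF s0] rho_catO[OF q] rho_catO[OF q]]
    by (simp add: catO groth_mult[OF q] add.commute)
qed

end
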